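(* Let $K\subset\mathbb{R}^2$ be a closed (compact), strictly convex domain enclosed by a smooth closed curve $\gamma$ with positive curvature $\kappa>0$. For real parameters $(\alpha,\delta,\mu,\sigma,\eta,\lambda,\xi,\zeta)$ put $$W:=\alpha\int_0^{2\pi}\rho(\theta)^2\,d\theta+\delta L^2+\mu A+\sigma|\tilde A|+\eta\int_0^{2\pi}\rho_\beta(\theta)^2\,d\theta+\lambda(\rho_e-\rho_i)^2+\xi(\rho_M-\rho_m)^2+\zeta\oint_\gamma\kappa^2\,ds .$$ (i) If the parameters satisfy $$\eta,\xi,\zeta\ge 0,\qquad \lambda\le 0,\qquad 2\alpha+4\pi\delta+\mu-4\zeta\ge 0,\qquad 2\alpha+\sigma-2\eta-4\zeta\ge 0,$$ $$6\pi\alpha-\pi\mu+4\pi\sigma+24\pi\eta+4\lambda+4\xi-12\pi\zeta\ge 0,$$ then $W\ge 0$. (ii) If $K$ is a disk and the parameters satisfy $2\alpha+4\pi\delta+\mu=0$ and $\zeta=0$, then $W=0$. (iii) Conversely, if $W=0$ and the parameters satisfy all the conditions listed in (i) together with $\lambda^2+\xi^2+\zeta^2>0$, then $K$ is a disk.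
   Context: Let $\theta$ be the angle between the $x$-axis and the outward normal vector of $\gamma$. The support function of $K$ is $p_K(\theta)=\max_{x\in K}\langle x,(\cos\theta,\sin\theta)\rangle$, which is $2\pi$-periodic and smooth, and $\gamma$ is parametrized by $\gamma(\theta)=(p_K\cos\theta-p_K'\sin\theta,\ p_K\sin\theta+p_K'\cos\theta)$. Notation: - $\kappa=1/(p_K+p_K'')$ is the curvature of $\gamma$, and $\rho(\theta)=1/\kappa(\theta)=p_K(\theta)+p_K''(\theta)$ is its curvature radius; $\rho_M,\rho_m$ are the maximum and minimum of $\rho$ over $[0,2\pi]$. - $L=\int_0^{2\pi}\rho\,d\theta$ is the length of $\gamma$, $A=\frac12\int_0^{2\pi}(p_K^2-p_K'^2)\,d\theta$ is the area of $K$, and $ds=\rho\,d\theta$ is arclength on $\gamma$. - $\beta$ is the locus of curvature centers of $\gamma$: $\beta(\theta)=\gamma(\theta)-\rho(\theta)(\cos\theta,\sin\theta)$. $\tilde A=\frac12\oint_\beta(\beta_1\,d\beta_2-\beta_2\,d\beta_1)=\frac12\int_0^{2\pi}(p_K'^2-p_K''^2)\,d\theta$ is the oriented area enclosed by $\beta$, and $\rho_\beta(\theta)=|p_K'(\theta)+p_K'''(\theta)|$ is the curvature radius of $\beta$. - $\rho_e$ and $\rho_i$ are the circumradius of $\gamma$ (radius of the smallest disk containing $K$) and the inradius (radius of the largest disk contained in $K$). *)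

theory Defs
  imports "HOL-Analysis.Analysis"
begin

definition smooth_map :: "(real \<Rightarrow> 'a::real_normed_vector) \<Rightarrow> bool" where
  "smooth_map c \<longleftrightarrow>
     (\<exists>D. D 0 = c \<and> (\<forall>n::nat. \<forall>t. (D n has_vector_derivative D (Suc n) t) (at t)))"

abbreviation velocity :: "(real \<Rightarrow> real^2) \<Rightarrow> real \<Rightarrow> real^2" where
  "velocity c t \<equiv> vector_derivative c (at t)"

definition signed_curvature :: "(real \<Rightarrow> real^2) \<Rightarrow> real \<Rightarrow> real" where
  "signed_curvature c t =
     (velocity c t $ 1 * velocity (velocity c) t $ 2 - velocity c t $ 2 * velocity (velocity c) t $ 1)
       / norm (velocity c t) ^ 3"

text \<open>A closed curve is given as a periodic map on the whole line, so that it is smooth also where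
  it closes up.  Positive signed curvature fixes the counterclockwise orientation of the boundary.\<close>

definition pos_curved_boundary :: "(real^2) set \<Rightarrow> (real \<Rightarrow> real^2) \<Rightarrow> bool" where
  "pos_curved_boundary K c \<longleftrightarrow>
     smooth_map c \<and>
     (\<forall>t. velocity c t \<noteq> 0) \<and>
     (\<exists>T>0. (\<forall>t. c (t + T) = c t) \<and> inj_on c {0..<T}) \<and>
     frontier K = range c \<and>
     (\<forall>t. signed_curvature c t > 0)"

definition strictly_convex :: "'a::euclidean_space set \<Rightarrow> bool" where
  "strictly_convex K \<longleftrightarrow>
     convex K \<and> (\<forall>x\<in>K. \<forall>y\<in>K. x \<noteq> y \<longrightarrow> open_segment x y \<subseteq> interior K)"

definition smooth_strictly_convex_domain :: "(real^2) set \<Rightarrow> bool" where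
  "smooth_strictly_convex_domain K \<longleftrightarrow>
     compact K \<and> interior K \<noteq> {} \<and> strictly_convex K \<and> (\<exists>c. pos_curved_boundary K c)"

definition is_disk :: "(real^2) set \<Rightarrow> bool" where
  "is_disk K \<longleftrightarrow> (\<exists>x r. r > 0 \<and> K = cball x r)"

definition normal_vec :: "real \<Rightarrow> real^2" where
  "normal_vec \<theta> = vector [cos \<theta>, sin \<theta>]"

definition support_fun :: "(real^2) set \<Rightarrow> real \<Rightarrow> real" where
  "support_fun K \<theta> = (SUP x\<in>K. x \<bullet> normal_vec \<theta>)"

definition bdry_curve :: "(real^2) set \<Rightarrow> real \<Rightarrow> real^2" where
  "bdry_curve K \<theta> = vector
     [support_fun K \<theta> * cos \<theta> - deriv (support_fun K) \<theta> * sin \<theta>,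
      support_fun K \<theta> * sin \<theta> + deriv (support_fun K) \<theta> * cos \<theta>]"

definition curv_radius :: "(real^2) set \<Rightarrow> real \<Rightarrow> real" where
  "curv_radius K \<theta> = support_fun K \<theta> + (deriv ^^ 2) (support_fun K) \<theta>"

text \<open>Curvature as a function of the normal angle, so that arclength is
  \<^term>\<open>curv_radius K \<theta>\<close> times \<open>d\<theta>\<close>.\<close>

definition curvature :: "(real^2) set \<Rightarrow> real \<Rightarrow> real" where
  "curvature K \<theta> = 1 / curv_radius K \<theta>"

definition max_curv_radius :: "(real^2) set \<Rightarrow> real" where
  "max_curv_radius K = (SUP \<theta>\<in>{0..2*pi}. curv_radius K \<theta>)"

definition min_curv_radius :: "(real^2) set \<Rightarrow> real" where
  "min_curv_radius K = (INF \<theta>\<in>{0..2*pi}. curv_radius K \<theta>)"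

definition bdry_length :: "(real^2) set \<Rightarrow> real" where
  "bdry_length K = integral {0..2*pi} (curv_radius K)"

definition area :: "(real^2) set \<Rightarrow> real" where
  "area K = 1/2 * integral {0..2*pi} (\<lambda>\<theta>. (support_fun K \<theta>)\<^sup>2 - (deriv (support_fun K) \<theta>)\<^sup>2)"

definition evolute :: "(real^2) set \<Rightarrow> real \<Rightarrow> real^2" where
  "evolute K \<theta> = bdry_curve K \<theta> - curv_radius K \<theta> *\<^sub>R normal_vec \<theta>"

definition evolute_area :: "(real^2) set \<Rightarrow> real" where
  "evolute_area K = 1/2 * integral {0..2*pi}
     (\<lambda>\<theta>. evolute K \<theta> $ 1 * deriv (\<lambda>t. evolute K t $ 2) \<theta>
        - evolute K \<theta> $ 2 * deriv (\<lambda>t. evolute K t $ 1) \<theta>)"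

definition evolute_curv_radius :: "(real^2) set \<Rightarrow> real \<Rightarrow> real" where
  "evolute_curv_radius K \<theta> = \<bar>deriv (support_fun K) \<theta> + (deriv ^^ 3) (support_fun K) \<theta>\<bar>"

definition circumradius :: "'a::metric_space set \<Rightarrow> real" where
  "circumradius K = Inf {r. r \<ge> 0 \<and> (\<exists>x. K \<subseteq> cball x r)}"

definition inradius :: "'a::metric_space set \<Rightarrow> real" where
  "inradius K = Sup {r. r \<ge> 0 \<and> (\<exists>x. cball x r \<subseteq> K)}"

definition W ::
  "(real^2) set \<Rightarrow> real \<Rightarrow> real \<Rightarrow> real \<Rightarrow> real \<Rightarrow> real \<Rightarrow> real \<Rightarrow> real \<Rightarrow> real \<Rightarrow> real" where
  "W K \<alpha> \<delta> \<mu> \<sigma> \<eta> lam \<xi> \<zeta> =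
     \<alpha> * integral {0..2*pi} (\<lambda>\<theta>. (curv_radius K \<theta>)\<^sup>2)
     + \<delta> * (bdry_length K)\<^sup>2
     + \<mu> * area K
     + \<sigma> * \<bar>evolute_area K\<bar>
     + \<eta> * integral {0..2*pi} (\<lambda>\<theta>. (evolute_curv_radius K \<theta>)\<^sup>2)
     + lam * (circumradius K - inradius K)\<^sup>2
     + \<xi> * (max_curv_radius K - min_curv_radius K)\<^sup>2
     + \<zeta> * integral {0..2*pi} (\<lambda>\<theta>. (curvature K \<theta>)\<^sup>2 * curv_radius K \<theta>)"

definition admissible ::
  "real \<Rightarrow> real \<Rightarrow> real \<Rightarrow> real \<Rightarrow> real \<Rightarrow> real \<Rightarrow> real \<Rightarrow> real \<Rightarrow> bool" where
  "admissible \<alpha> \<delta> \<mu> \<sigma> \<eta> lam \<xi> \<zeta> \<longleftrightarrow>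
     \<eta> \<ge> 0 \<and> \<xi> \<ge> 0 \<and> \<zeta> \<ge> 0 \<and> lam \<le> 0 \<and>
     2*\<alpha> + 4*pi*\<delta> + \<mu> - 4*\<zeta> \<ge> 0 \<and>
     2*\<alpha> + \<sigma> - 2*\<eta> - 4*\<zeta> \<ge> 0 \<and>
     6*pi*\<alpha> - pi*\<mu> + 4*pi*\<sigma> + 24*pi*\<eta> + 4*lam + 4*\<xi> - 12*pi*\<zeta> \<ge> 0"

end

theory Submission
  imports Defs
begin

text \<open>
  Everything is expressed through the support function \<open>p\<close>. Let \<open>\<rho> = p + p''\<close>, let \<open>V\<close> be the integral over a period of
  the square of \<open>\<rho>\<close> minus its mean, and let \<open>E = L\<^sup>2 / (2 \<pi>) - 2 A\<close>, a multiple of the isoperimetric deficit. Then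
  \<open>\<integral>\<rho>\<^sup>2 = L\<^sup>2 / (2 \<pi>) + V\<close>, and the evolute encloses the signed area \<open>- (V + E) / 2\<close>, so \<open>W\<close> is a linear combination
  of \<open>L\<^sup>2\<close>, \<open>V\<close>, \<open>E\<close>, \<open>\<integral>\<rho>'\<^sup>2\<close>, the two squared gaps \<open>(\<rho>\<^sub>e - \<rho>\<^sub>i)\<^sup>2\<close> and \<open>(\<rho>\<^sub>M - \<rho>\<^sub>m)\<^sup>2\<close>, and \<open>\<integral>\<kappa>\<^sup>2 ds\<close>.

  The mean of \<open>\<rho>\<close> and the first harmonics of \<open>p\<close> do not enter \<open>V\<close> and \<open>E\<close>, and on what remains the frequencies are at
  least \<open>2\<close>. Hence \<open>\<integral>\<rho>'\<^sup>2 \<ge> 4 V\<close> and \<open>V \<ge> 3 E \<ge> 0\<close>. Both follow from a Wirtinger inequality of second order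
  (\<open>wirtinger_second_order\<close>), with equality exactly if only the second harmonics are left. The signs of the coefficients of
  \<open>L\<^sup>2\<close>, \<open>V\<close> and \<open>\<integral>\<rho>'\<^sup>2\<close> are controlled by the conditions on the parameters, so \<open>W\<close> is bounded below by \<open>b E\<close>, for
  some \<open>b\<close>, plus the terms with \<open>\<lambda>\<close>, \<open>\<xi>\<close> and \<open>\<zeta>\<close> (\<open>W_lower_bound\<close>). The last of the conditions is
  \<open>b \<ge> - 2 (\<lambda> + \<xi>) / \<pi>\<close>, and it remains to compare the two squared gaps with \<open>2 E / \<pi>\<close>.

  \<^item> Bonnesen's inequality \<open>(\<rho>\<^sub>e - \<rho>\<^sub>i)\<^sup>2 \<le> 2 E / \<pi>\<close>, with equality only for disks. If \<open>q\<close> is \<open>p\<close> minus the support function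
    of the smallest enclosing disk, then \<open>q \<le> 0\<close>, and \<open>q\<close> vanishes in every closed half circle of directions, since
    otherwise the disk could be moved and shrunk. Three zeros of \<open>q\<close> therefore cut the circle into arcs of length at most \<open>\<pi>\<close>, on each
    of which \<open>\<integral>q\<^sup>2 \<le> \<integral>q'\<^sup>2\<close>. Summed up, this is \<open>A - L \<rho>\<^sub>e + \<pi> \<rho>\<^sub>e\<^sup>2 \<le> 0\<close>. Applied to \<open>-p\<close>, the same argument gives
    \<open>A - L \<rho>\<^sub>i + \<pi> \<rho>\<^sub>i\<^sup>2 \<le> 0\<close>, so both radii lie between the roots of one quadratic polynomial.

  \<^item> Bottema's inequality in the stronger form \<open>6 E / \<pi> \<le> (\<rho>\<^sub>M - \<rho>\<^sub>m)\<^sup>2\<close>: it follows from \<open>3 E \<le> V\<close>, because a function with values in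
    an interval of length \<open>d\<close> has variance at most \<open>d\<^sup>2 / 4\<close>.

  \<^item> The term with \<open>\<zeta>\<close> is compensated by replacing \<open>\<alpha>\<close> by \<open>\<alpha> - 2 \<zeta>\<close>; what remains of it is
    \<open>\<zeta> (\<integral>\<kappa>\<^sup>2 ds + 2 \<integral>\<rho>\<^sup>2)\<close>, which is positive unless \<open>\<zeta> = 0\<close>.

  If \<open>W = 0\<close> then each of the nonnegative remainders is zero, so \<open>\<zeta> = 0\<close>, and \<open>\<lambda> \<noteq> 0\<close> forces
  equality in Bonnesen's inequality while \<open>\<xi> \<noteq> 0\<close> forces \<open>E = 0\<close>; in both cases the domain is a disk.

  That \<open>p\<close> is three times continuously differentiable has to be derived from the boundary curve. Positive curvature makes the normal angle
  a strictly increasing function of the parameter with positive derivative, so the curve can be parametrized by the normal angle, and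
  \<open>p\<close> is the inner product of this parametrization with the normal (\<open>domain_support_smooth\<close>).
\<close>

section \<open>Wirtinger's inequality on an interval\<close>

lemma integral_of_derivative:
  fixes F f :: "real \<Rightarrow> real"
  assumes "\<And>x. (F has_real_derivative f x) (at x)" and "a \<le> b"
  shows "integral {a..b} f = F b - F a"
proof (rule integral_unique, rule fundamental_theorem_of_calculus)
  show "(F has_vector_derivative f x) (at x within {a..b})" for x
    using assms(1)[of x] has_field_derivative_at_within has_real_derivative_iff_has_vector_derivative by blast
qed fact

lemma continuous_primitive:
  fixes f :: "real \<Rightarrow> real"
  assumes "continuous_on UNIV f"
  obtains F where "\<And>x. (F has_real_derivative f x) (at x)"
proof -
  have "\<exists>F. \<forall>x::real. -\<infinity> < ereal x \<longrightarrow> ereal x < \<infinity> \<longrightarrow> (F has_vector_derivative f x) (at x)"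
    using assms by (intro einterval_antiderivative) (auto simp: continuous_on_eq_continuous_at)
  with that show ?thesis
    by (auto simp: has_real_derivative_iff_has_vector_derivative)
qed

lemma integral_periodic_shift:
  fixes f :: "real \<Rightarrow> real"
  assumes "continuous_on UNIV f" and per: "\<And>x. f (x + 2*pi) = f x"
  shows "integral {a..a+2*pi} f = integral {0..2*pi} f"
proof -
  obtain F where F: "\<And>x. (F has_real_derivative f x) (at x)"
    using continuous_primitive assms(1) by blast
  have "((\<lambda>x. F (x + 2*pi) - F x) has_real_derivative 0) (at x)" for x
    using DERIV_diff[OF iffD1[OF DERIV_shift F[of "x+2*pi"]] F[of x]] by (simp add: per)
  then have "F (a + 2*pi) - F a = F (0 + 2*pi) - F 0"
    using DERIV_const_ratio_const DERIV_isconst_all by blast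
  then show ?thesis by (simp add: integral_of_derivative[OF F])
qed

lemma derivative_periodic:
  fixes u v :: "real \<Rightarrow> real"
  assumes u: "\<And>x. (u has_real_derivative v x) (at x)" and per: "\<And>x. u (x + T) = u x"
  shows "v (x + T) = v x"
  using iffD1[OF DERIV_shift u[of "x + T"]] u[of x] per DERIV_unique by fastforce

lemma square_cot_tendsto_zero:
  fixes q :: "real \<Rightarrow> real"
  assumes q: "(q has_real_derivative d) (at z)" "q z = 0" and w: "w > 0"
  shows "((\<lambda>x. (q x)\<^sup>2 * cot (w * (x - z))) \<longlongrightarrow> 0) (at z)"
proof -
  have 1: "((\<lambda>x. q x / (x - z)) \<longlongrightarrow> d) (at z)"
    using q by (simp add: has_field_derivative_iff)
  have "((\<lambda>x. sin (w * (x - z))) has_real_derivative w) (at z)"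
    by (auto intro!: derivative_eq_intros)
  then have 2: "((\<lambda>x. sin (w * (x - z)) / (x - z)) \<longlongrightarrow> w) (at z)"
    by (simp add: has_field_derivative_iff)
  have 3: "(q \<longlongrightarrow> 0) (at z)"
    using DERIV_isCont[OF q(1)] q(2) by (simp add: isCont_def)
  have 4: "((\<lambda>x. cos (w * (x - z))) \<longlongrightarrow> 1) (at z)"
    by (rule tendsto_eq_intros refl | simp)+
  have "((\<lambda>x. q x / (x - z) * q x * cos (w * (x - z)) / (sin (w * (x - z)) / (x - z))) \<longlongrightarrow> d * 0 * 1 / w) (at z)"
    by (intro tendsto_intros 1 2 3 4) (use w in auto)
  then have "((\<lambda>x. q x / (x - z) * q x * cos (w * (x - z)) / (sin (w * (x - z)) / (x - z))) \<longlongrightarrow> 0) (at z)" by simp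
  then show ?thesis
    by (rule Lim_transform_eventually)
      (auto simp: eventually_at_filter power2_eq_square cot_def)
qed

lemma sin_pos_in_half_period:
  fixes a b w x :: real
  assumes w: "w > 0" "w * (b - a) \<le> pi" and x: "a < x" "x < b"
  shows "sin (w * (x - a)) > 0"
proof (rule sin_gt_zero)
  show "0 < w * (x - a)" using w x by simp
  have "w * (x - a) < w * (b - a)" using w x by simp
  then show "w * (x - a) < pi" using w(2) by linarith
qed

text \<open>The function \<open>s(x) = sin (w (x - a))\<close> is positive inside the interval and solves \<open>s'' = - w\<^sup>2 s\<close>, hence
  \<open>q'\<^sup>2 - w\<^sup>2 q\<^sup>2 = (q' - q s'/s)\<^sup>2 + (q\<^sup>2 s'/s)'\<close>. So the indefinite integral of the left side minus \<open>q\<^sup>2 s'/s\<close> is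
  nondecreasing. The boundary term \<open>q\<^sup>2 s'/s = w q\<^sup>2 cot (w (x - a))\<close> tends to zero at the end points because \<open>q\<close> vanishes there to first
  order and the cotangent has at most a simple pole.\<close>

lemma wirtinger_dirichlet:
  fixes q q1 :: "real \<Rightarrow> real"
  assumes ab: "a < b" and w: "w > 0" "w * (b - a) \<le> pi"
    and q: "\<And>x. (q has_real_derivative q1 x) (at x)" and q1: "continuous_on UNIV q1"
    and qa: "q a = 0" and qb: "q b = 0"
  shows "integral {a..b} (\<lambda>x. (q1 x)\<^sup>2 - w\<^sup>2 * (q x)\<^sup>2) \<ge> 0"
    and "integral {a..b} (\<lambda>x. (q1 x)\<^sup>2 - w\<^sup>2 * (q x)\<^sup>2) = 0 \<Longrightarrow> a < x \<Longrightarrow> x < b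
           \<Longrightarrow> q1 x = w * q x * cot (w * (x - a))"
proof -
  have cq: "continuous_on UNIV q"
    using q DERIV_isCont by (auto simp: continuous_on_eq_continuous_at)
  have "continuous_on UNIV (\<lambda>x. (q1 x)\<^sup>2 - w\<^sup>2 * (q x)\<^sup>2)"
    by (intro continuous_intros cq q1)
  then obtain P where P: "\<And>x. (P has_real_derivative (q1 x)\<^sup>2 - w\<^sup>2 * (q x)\<^sup>2) (at x)"
    using continuous_primitive by blast
  have int: "integral {a..b} (\<lambda>x. (q1 x)\<^sup>2 - w\<^sup>2 * (q x)\<^sup>2) = P b - P a"
    using integral_of_derivative[OF P] ab by simp
  define H where "H x = P x - w * ((q x)\<^sup>2 * cot (w * (x - a)))" for x
  have sin_pos: "sin (w * (x - a)) > 0" if "a < x" "x < b" for x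
    using sin_pos_in_half_period[OF w that] .
  have dH: "(H has_real_derivative (q1 x - w * q x * cot (w * (x - a)))\<^sup>2) (at x)"
    if "a < x" "x < b" for x
  proof -
    let ?s = "sin (w * (x - a))" and ?c = "cos (w * (x - a))"
    have s: "?s \<noteq> 0" using sin_pos[OF that] by simp
    have "((\<lambda>x. w * (x - a)) has_real_derivative w) (at x)"
      by (auto intro!: derivative_eq_intros)
    then have cot: "((\<lambda>x. cot (w * (x - a))) has_real_derivative - inverse (?s\<^sup>2) * w) (at x)"
      by (rule DERIV_chain2[where g = "\<lambda>x. w * (x - a)", OF DERIV_cot[OF s]])
    have "(H has_real_derivative ((q1 x)\<^sup>2 - w\<^sup>2 * (q x)\<^sup>2
        - w * (2 * q x * q1 x * cot (w * (x - a)) + (q x)\<^sup>2 * (- inverse (?s\<^sup>2) * w)))) (at x)"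
      unfolding H_def
      by (rule DERIV_cong, rule DERIV_diff[OF P DERIV_cmult[OF DERIV_mult[OF DERIV_power[OF q, of 2] cot]]])
         (simp add: algebra_simps)
    moreover have "(q1 x)\<^sup>2 - w\<^sup>2 * (q x)\<^sup>2
        - w * (2 * q x * q1 x * cot (w * (x - a)) + (q x)\<^sup>2 * (- inverse (?s\<^sup>2) * w))
        = (q1 x - w * q x * cot (w * (x - a)))\<^sup>2"
    proof -
      have "inverse (?s\<^sup>2) = (cot (w * (x - a)))\<^sup>2 + 1"
        using s by (simp add: cot_def power_divide cos_squared_eq field_simps)
      then show ?thesis
        by (simp only:) (simp add: power2_eq_square algebra_simps)
    qed
    ultimately show ?thesis by simp
  qed
  have cP: "(P \<longlongrightarrow> P x) (at x)" for x
    using DERIV_isCont[OF P] by (simp add: isCont_def)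
  \<comment> \<open>At a pole the value of the cotangent is \<open>0\<close> by convention, as is the limit of the product with \<open>q\<^sup>2\<close>, so continuity
    holds also there. A pole at \<open>b\<close> occurs exactly if \<open>w (b - a) = \<pi>\<close>.\<close>
  have cH: "continuous_on {a..b} H"
    unfolding continuous_on
  proof
    fix x assume x: "x \<in> {a..b}"
    consider "x = a" | "x = b" "w * (b - a) = pi" | "x = b" "w * (b - a) < pi" | "a < x" "x < b"
      using x w by fastforce
    then show "(H \<longlongrightarrow> H x) (at x within {a..b})"
    proof cases
      case 1
      have "(H \<longlongrightarrow> P a - w * 0) (at a)"
        unfolding H_def by (intro tendsto_intros cP square_cot_tendsto_zero[OF q qa w(1)])
      then have "(H \<longlongrightarrow> H x) (at x)" using 1 qa by (simp add: H_def)
      then show ?thesis by (rule tendsto_within_subset) simp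
    next
      case 2
      have "w * (x - a) = w * (x - b) + pi" for x using 2 by (simp add: algebra_simps)
      then have "cot (w * (x - a)) = cot (w * (x - b))" for x
        by (simp add: cot_def)
      moreover have "((\<lambda>x. P x - w * ((q x)\<^sup>2 * cot (w * (x - b)))) \<longlongrightarrow> P b - w * 0) (at b)"
        by (intro tendsto_intros cP square_cot_tendsto_zero[OF q qb w(1)])
      ultimately have "(H \<longlongrightarrow> H x) (at x)" using 2 qb by (simp add: H_def [abs_def])
      then show ?thesis by (rule tendsto_within_subset) simp
    next
      case 3
      have "sin (w * (x - a)) \<noteq> 0" using 3 w ab sin_gt_zero[of "w * (x - a)"] by simp
      then have "isCont H x" unfolding H_def
        by (intro continuous_intros DERIV_isCont[OF P] DERIV_isCont[OF q])
      then show ?thesis using continuous_at_imp_continuous_at_within continuous_within by blast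
    next
      case 4
      then show ?thesis using DERIV_isCont[OF dH]
        using continuous_at_imp_continuous_at_within continuous_within by blast
    qed
  qed
  have mono: "H x \<le> H y" if "a \<le> x" "x \<le> y" "y \<le> b" for x y
  proof (rule DERIV_nonneg_imp_increasing_open[OF \<open>x \<le> y\<close>])
    show "continuous_on {x..y} H" using cH continuous_on_subset that by fastforce
  qed (use dH that in force)
  have ends: "H a = P a" "H b = P b" using qa qb by (simp_all add: H_def)
  show "integral {a..b} (\<lambda>x. (q1 x)\<^sup>2 - w\<^sup>2 * (q x)\<^sup>2) \<ge> 0"
    using mono[of a b] ab int ends by simp
  assume "integral {a..b} (\<lambda>x. (q1 x)\<^sup>2 - w\<^sup>2 * (q x)\<^sup>2) = 0" and x: "a < x" "x < b"
  then have "H y = H a" if "a < y" "y < b" for y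
    using mono[of a y] mono[of y b] that int ends by simp
  then have "eventually (\<lambda>y. H y = H a) (nhds x)"
    using x by (auto simp: eventually_nhds intro!: exI[of _ "{a<..<b}"])
  then have "(H has_real_derivative 0) (at x)"
    using DERIV_cong_ev[of x x H "\<lambda>_. H a" 0 0] by simp
  then have "(q1 x - w * q x * cot (w * (x - a)))\<^sup>2 = 0" using dH[OF x] DERIV_unique by blast
  then show "q1 x = w * q x * cot (w * (x - a))" by simp
qed

text \<open>Equality makes \<open>q\<close> a constant multiple of \<open>sin (w (x - a))\<close>, and the constant is
  determined by the derivative at \<open>a\<close>. In the application \<open>q\<close> has one sign, so that its zeros are critical points.\<close>

lemma wirtinger_dirichlet_equality:
  fixes q q1 :: "real \<Rightarrow> real"
  assumes ab: "a < b" and w: "w > 0" "w * (b - a) \<le> pi"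
    and q: "\<And>x. (q has_real_derivative q1 x) (at x)" and q1: "continuous_on UNIV q1"
    and qa: "q a = 0" and qb: "q b = 0" and q1a: "q1 a = 0"
    and eq: "integral {a..b} (\<lambda>x. (q1 x)\<^sup>2 - w\<^sup>2 * (q x)\<^sup>2) = 0"
    and x: "a \<le> x" "x \<le> b"
  shows "q x = 0"
proof -
  have sin_pos: "sin (w * (y - a)) > 0" if "a < y" "y < b" for y
    using sin_pos_in_half_period[OF w that] .
  define r where "r y = q y / sin (w * (y - a))" for y
  have dr: "(r has_real_derivative 0) (at y)" if y: "a < y" "y < b" for y
  proof -
    have "q1 y = w * q y * cot (w * (y - a))"
      using wirtinger_dirichlet(2)[OF ab w q q1 qa qb eq y] .
    then have "q1 y * sin (w * (y - a)) = q y * (w * cos (w * (y - a)))"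
      using sin_pos[OF y] by (simp add: cot_def)
    then show ?thesis unfolding r_def using sin_pos[OF y]
      by (auto intro!: derivative_eq_intros q)
  qed
  have r_lim: "(r \<longlongrightarrow> 0) (at a)"
  proof -
    have 1: "((\<lambda>x. q x / (x - a)) \<longlongrightarrow> 0) (at a)"
      using q[of a] qa q1a by (simp add: has_field_derivative_iff)
    have "((\<lambda>x. sin (w * (x - a))) has_real_derivative w) (at a)"
      by (auto intro!: derivative_eq_intros)
    then have 2: "((\<lambda>x. sin (w * (x - a)) / (x - a)) \<longlongrightarrow> w) (at a)"
      by (simp add: has_field_derivative_iff)
    have "((\<lambda>x. (q x / (x - a)) / (sin (w * (x - a)) / (x - a))) \<longlongrightarrow> 0 / w) (at a)"
      by (intro tendsto_intros 1 2) (use w in auto)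
    then have "((\<lambda>x. (q x / (x - a)) / (sin (w * (x - a)) / (x - a))) \<longlongrightarrow> 0) (at a)" by simp
    then show ?thesis
      by (rule Lim_transform_eventually) (auto simp: eventually_at_filter r_def)
  qed
  have r0: "r y = 0" if y: "a < y" "y < b" for y
  proof -
    have "r z = r y" if z: "a < z" "z < b" for z
    proof -
      have *: "r u = r v" if "a < u" "u < v" "v < b" for u v
      proof -
        have d: "(r has_real_derivative 0) (at y)" if "u \<le> y" "y \<le> v" for y
          using dr that \<open>a < u\<close> \<open>v < b\<close> by simp
        then have "continuous_on {u..v} r"
          by (intro continuous_at_imp_continuous_on ballI) (auto intro: DERIV_isCont)
        with d show ?thesis using DERIV_isconst_end[OF \<open>u < v\<close>, of r] by simp
      qed
      show ?thesis
      proof (cases z y rule: linorder_cases)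
        case less then show ?thesis using z y by (intro *)
      next
        case greater then show ?thesis using z y by (intro *[symmetric])
      qed simp
    qed
    then have "eventually (\<lambda>z. r z = r y) (at_right a)"
      using eventually_at_right_real[OF ab] by (auto elim: eventually_mono)
    moreover have "(r \<longlongrightarrow> 0) (at_right a)" using r_lim
      by (simp add: filterlim_at_split)
    ultimately have "((\<lambda>_. r y) \<longlongrightarrow> 0) (at_right a)"
      by (rule Lim_transform_eventually[rotated])
    then show ?thesis by (simp add: tendsto_const_iff)
  qed
  show ?thesis
  proof (cases "x = a \<or> x = b")
    case False
    then have "a < x" "x < b" using x by auto
    then have "r x = 0" "sin (w * (x - a)) \<noteq> 0" using r0 sin_pos[of x] by auto
    then show ?thesis by (simp add: r_def)
  qed (use qa qb in auto)
qed

section \<open>Wirtinger's inequality of second order on the circle\<close>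

abbreviation circ :: "(real \<Rightarrow> real) \<Rightarrow> real" where
  "circ f \<equiv> integral {0..2*pi} f"

lemma continuous_integrable_circle [simp]:
  fixes f :: "real \<Rightarrow> real"
  assumes "continuous_on UNIV f"
  shows "f integrable_on {0..2*pi}"
  by (metis assms continuous_on_subset integrable_continuous_interval subset_UNIV)

lemma circ_add:
  assumes "continuous_on UNIV f" "continuous_on UNIV g"
  shows "circ (\<lambda>x. f x + g x) = circ f + circ g"
  using assms by (simp add: integral_add)

lemma circ_diff:
  assumes "continuous_on UNIV f" "continuous_on UNIV g"
  shows "circ (\<lambda>x. f x - g x) = circ f - circ g"
  using assms by (simp add: integral_diff)

lemma circ_nonneg:
  assumes "\<And>x. f x \<ge> 0"
  shows "circ f \<ge> 0"
proof (cases "f integrable_on {0..2*pi}")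
  case True
  then show ?thesis using assms by (intro integral_nonneg) auto
qed (simp add: not_integrable_integral)

lemma circ_pos_zero:
  assumes "continuous_on UNIV f" "\<And>x. f x \<ge> 0" "circ f \<le> 0" "0 \<le> x" "x \<le> 2*pi"
  shows "f x = 0"
proof (rule has_integral_0_cbox_imp_0[of 0 "2*pi" f])
  have "circ f = 0" using circ_nonneg[of f] assms by simp
  then show "(f has_integral 0) (cbox 0 (2*pi))"
    using integrable_integral[OF continuous_integrable_circle[OF assms(1)]] by simp
  show "continuous_on (cbox 0 (2*pi)) f" using assms(1) continuous_on_subset by blast
  have "pi \<in> box 0 (2*pi)" by simp
  then show "box 0 (2*pi) \<noteq> {}" by blast
qed (use assms in auto)

lemma circ_by_parts:
  assumes u: "\<And>x. (u has_real_derivative u1 x) (at x)" and v: "\<And>x. (v has_real_derivative v1 x) (at x)"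
    and c: "continuous_on UNIV u1" "continuous_on UNIV v1"
    and per: "u (2*pi) = u 0" "v (2*pi) = v 0"
  shows "circ (\<lambda>x. u1 x * v x) = - circ (\<lambda>x. u x * v1 x)"
proof -
  have cu: "continuous_on UNIV u" "continuous_on UNIV v"
    using DERIV_isCont[OF u] DERIV_isCont[OF v] by (auto simp: continuous_on_eq_continuous_at)
  have "circ (\<lambda>x. u1 x * v x + v1 x * u x) = u (2*pi) * v (2*pi) - u 0 * v 0"
    using integral_of_derivative[OF DERIV_mult[OF u v], of 0 "2*pi"] by simp
  then have "circ (\<lambda>x. u1 x * v x) + circ (\<lambda>x. v1 x * u x) = 0"
    using per by (subst (asm) circ_add) (auto intro!: continuous_intros c cu)
  then show ?thesis by (simp add: mult.commute)
qed

lemma circ_cos_sin: "circ cos = 0" "circ sin = 0"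
  using integral_of_derivative[OF DERIV_sin, of 0 "2*pi"]
    integral_of_derivative[of "\<lambda>x. - cos x" sin 0 "2*pi"]
  by (auto intro!: derivative_eq_intros)

lemma trig_three_quarters: "cos (3*pi/2 :: real) = 0" "sin (3*pi/2 :: real) = -1"
  using cos_add[of pi "pi/2"] sin_add[of pi "pi/2"] by (simp_all add: field_simps)

text \<open>The reason without Fourier series: if a function vanishes at four points with spacing \<open>\<pi>/2\<close>, then Wirtinger's inequality with \<open>w = 2\<close>
  applies on each quarter of the circle. This is achieved by adding \<open>h = A + B cos + C sin\<close> to \<open>f\<close>. By orthogonality the value of
  \<open>\<integral>u'\<^sup>2 - 4 u\<^sup>2\<close> at \<open>u = f + h\<close> is the sum of its values at \<open>f\<close> and at \<open>h\<close>, and the latter is at most \<open>0\<close>. Four values of \<open>f\<close> are to be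
  cancelled by three coefficients. The only obstruction is their alternating sum; it changes sign when the four points are rotated by
  \<open>\<pi>/2\<close> and therefore vanishes for a suitable starting point \<open>x0\<close>.\<close>

lemma wirtinger_second_order:
  fixes f f1 :: "real \<Rightarrow> real"
  assumes f: "\<And>x. (f has_real_derivative f1 x) (at x)" and f1: "continuous_on UNIV f1"
    and per: "\<And>x. f (x + 2*pi) = f x"
    and orth: "circ f = 0" "circ (\<lambda>x. f x * cos x) = 0" "circ (\<lambda>x. f x * sin x) = 0"
  shows "4 * circ (\<lambda>x. (f x)\<^sup>2) \<le> circ (\<lambda>x. (f1 x)\<^sup>2)"
proof -
  have cf: "continuous_on UNIV f"
    using DERIV_isCont[OF f] by (auto simp: continuous_on_eq_continuous_at)
  define s where "s x = f x - f (x + pi/2) + f (x + pi) - f (x + 3*pi/2)" for x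
  have cs: "continuous_on {0..pi/2} s" unfolding s_def
    by (intro continuous_intros continuous_on_compose2[OF cf]) auto
  have "s (pi/2) = - s 0"
    using per[of 0] by (simp add: s_def add_divide_distrib[symmetric] field_simps)
  then obtain x0 where x0: "s x0 = 0"
    using IVT'[of s 0 0 "pi/2"] IVT2'[of s "pi/2" 0 0] cs
    by (cases "s 0 \<le> 0") force+
  define A where "A = - (f x0 + f (x0 + pi)) / 2"
  define B where "B = - (f x0 - f (x0 + pi)) / 2"
  define C where "C = - (f (x0 + pi/2) - f (x0 + 3*pi/2)) / 2"
  define b where "b = B * cos x0 - C * sin x0"
  define c where "c = B * sin x0 + C * cos x0"
  define h where "h x = A + b * cos x + c * sin x" for x
  define h1 where "h1 x = c * cos x - b * sin x" for x
  have h_alt: "h x = A + B * cos (x - x0) + C * sin (x - x0)" for x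
    by (simp add: h_def b_def c_def cos_diff sin_diff algebra_simps)
  have h: "(h has_real_derivative h1 x) (at x)" for x
    unfolding h_def h1_def by (auto intro!: derivative_eq_intros)
  have h1: "(h1 has_real_derivative A - h x) (at x)" for x
    unfolding h_def h1_def by (auto intro!: derivative_eq_intros)
  have ch: "continuous_on UNIV h" "continuous_on UNIV h1"
    unfolding h_def h1_def by (intro continuous_intros)+
  define q where "q x = f x + h x" for x
  define q1 where "q1 x = f1 x + h1 x" for x
  have q: "(q has_real_derivative q1 x) (at x)" for x
    unfolding q_def q1_def by (intro DERIV_add f h)
  have cq: "continuous_on UNIV q" "continuous_on UNIV q1"
    unfolding q_def q1_def by (intro continuous_intros cf f1 ch)+
  have "continuous_on UNIV (\<lambda>x. (q1 x)\<^sup>2 - 2\<^sup>2 * (q x)\<^sup>2)"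
    by (intro continuous_intros cq)
  then obtain P where P: "\<And>x. (P has_real_derivative (q1 x)\<^sup>2 - 2\<^sup>2 * (q x)\<^sup>2) (at x)"
    using continuous_primitive by blast
  have h_grid: "h x0 = A + B" "h (x0 + pi/2) = A + C" "h (x0 + pi) = A - B"
    "h (x0 + 3*pi/2) = A - C" "h (x0 + 2*pi) = A + B"
    by (simp_all add: h_alt trig_three_quarters)
  have zeros: "q x0 = 0" "q (x0 + pi/2) = 0" "q (x0 + pi) = 0" "q (x0 + 3*pi/2) = 0" "q (x0 + 2*pi) = 0"
    using x0 per[of x0] unfolding q_def h_grid s_def A_def B_def C_def
    by (simp_all add: field_simps)
  have step: "P u \<le> P v" if "q u = 0" "q v = 0" "v = u + pi/2" for u v
    using wirtinger_dirichlet(1)[OF _ _ _ q cq(2) that(1,2), of 2] integral_of_derivative[OF P, of u v] that(3)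
    by simp
  have "P x0 \<le> P (x0 + 2*pi)"
    using step[OF zeros(1,2)] step[OF zeros(2,3)] step[OF zeros(3,4)] step[OF zeros(4,5)] by simp
  then have "0 \<le> integral {x0..x0+2*pi} (\<lambda>x. (q1 x)\<^sup>2 - 2\<^sup>2 * (q x)\<^sup>2)"
    using integral_of_derivative[OF P, of x0 "x0 + 2*pi"] by simp
  also have "\<dots> = circ (\<lambda>x. (q1 x)\<^sup>2 - 2\<^sup>2 * (q x)\<^sup>2)"
  proof (rule integral_periodic_shift)
    have "q (y + 2*pi) = q y" for y using per by (simp add: q_def h_def)
    then have "q1 (x + 2*pi) = q1 x" for x using derivative_periodic[of q, OF q] by blast
    then show "(q1 (x + 2*pi))\<^sup>2 - 2\<^sup>2 * (q (x + 2*pi))\<^sup>2 = (q1 x)\<^sup>2 - 2\<^sup>2 * (q x)\<^sup>2" for x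
      using per by (simp add: q_def h_def)
  qed (intro continuous_intros cq)
  also have "\<dots> = circ (\<lambda>x. ((f1 x)\<^sup>2 - 4 * (f x)\<^sup>2) + (2 * (f1 x * h1 x) - 8 * (f x * h x)) + ((h1 x * h1 x) - 4 * (h x)\<^sup>2))"
    by (rule arg_cong[where f = circ], rule ext) (simp add: q_def q1_def power2_eq_square algebra_simps)
  also have "\<dots> = circ (\<lambda>x. (f1 x)\<^sup>2) - 4 * circ (\<lambda>x. (f x)\<^sup>2)
      + (2 * circ (\<lambda>x. f1 x * h1 x) - 8 * circ (\<lambda>x. f x * h x))
      + (circ (\<lambda>x. h1 x * h1 x) - 4 * circ (\<lambda>x. (h x)\<^sup>2))"
    by (simp add: circ_add circ_diff continuous_intros cf f1 ch)
  finally have main: "0 \<le> \<dots>" .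
  have fh: "circ (\<lambda>x. f x * h x) = 0"
  proof -
    have "(\<lambda>x. f x * h x) = (\<lambda>x. A * f x + b * (f x * cos x) + c * (f x * sin x))"
      by (simp add: h_def algebra_simps)
    then show ?thesis using orth by (simp add: circ_add continuous_intros cf)
  qed
  have "circ (\<lambda>x. f1 x * h1 x) = - circ (\<lambda>x. f x * (A - h x))"
    using per[of 0] by (intro circ_by_parts f h1 f1) (auto intro!: continuous_intros ch simp: h1_def)
  also have "(\<lambda>x. f x * (A - h x)) = (\<lambda>x. A * f x - f x * h x)"
    by (simp add: algebra_simps)
  also have "circ \<dots> = 0" using orth fh by (simp add: circ_diff continuous_intros cf ch)
  finally have f1h1: "circ (\<lambda>x. f1 x * h1 x) = 0" by simp
  \<comment> \<open>Since \<open>h'' = A - h\<close>, the value at \<open>h\<close> is \<open>- 2 \<pi> A\<^sup>2 - 3 \<integral>h\<^sup>2\<close>.\<close>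
  have "circ (\<lambda>x. h1 x * h1 x) = - circ (\<lambda>x. h x * (A - h x))"
    by (intro circ_by_parts h h1) (auto intro!: continuous_intros ch simp: h_def h1_def)
  also have "(\<lambda>x. h x * (A - h x)) = (\<lambda>x. A * h x - (h x)\<^sup>2)"
    by (simp add: algebra_simps power2_eq_square)
  also have "circ \<dots> = A * circ h - circ (\<lambda>x. (h x)\<^sup>2)" by (simp add: circ_diff continuous_intros ch)
  also have "circ h = 2 * pi * A"
    unfolding h_def by (simp add: circ_add continuous_intros circ_cos_sin)
  finally have "circ (\<lambda>x. h1 x * h1 x) = circ (\<lambda>x. (h x)\<^sup>2) - 2 * pi * A\<^sup>2"
    by (simp add: power2_eq_square)
  moreover have "0 \<le> 2 * pi * A\<^sup>2" by simp
  moreover have "circ (\<lambda>x. (h x)\<^sup>2) \<ge> 0" by (rule circ_nonneg) simp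
  ultimately show ?thesis using main fh f1h1 by linarith
qed

section \<open>Periodic support functions\<close>

lemma periodic_int_shift:
  fixes f :: "real \<Rightarrow> real"
  assumes "\<And>x. f (x + 2*pi) = f x"
  shows "f (x + 2 * pi * of_int k) = f x"
proof (induction k rule: int_induct[where k = 0])
  case (step1 i)
  then show ?case using assms[of "x + 2 * pi * of_int i"] by (simp add: algebra_simps)
next
  case (step2 i)
  then show ?case using assms[of "x + 2 * pi * of_int (i - 1)"] by (simp add: algebra_simps)
qed simp

lemma periodic_reduce:
  obtains k :: int where "a \<le> x + 2 * pi * of_int k" "x + 2 * pi * of_int k < a + 2 * pi"
proof
  define n where "n = \<lfloor>(x - a) / (2*pi)\<rfloor>"
  have "of_int n \<le> (x - a) / (2*pi)" "(x - a) / (2*pi) < of_int n + 1"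
    unfolding n_def by linarith+
  then have "of_int n * (2*pi) \<le> x - a" "x - a < (of_int n + 1) * (2*pi)"
    by (simp_all add: pos_le_divide_eq pos_divide_less_eq)
  then show "a \<le> x + 2 * pi * of_int (-n)" "x + 2 * pi * of_int (-n) < a + 2 * pi"
    by (simp_all add: algebra_simps)
qed

text \<open>The derivatives are part of the data, so that no differentiability has to be proved again. With \<open>p\<close> the support
  function of a convex domain, \<open>p + p2\<close> is the curvature radius.\<close>

locale smooth_periodic =
  fixes p p1 p2 p3 :: "real \<Rightarrow> real"
  assumes p: "(p has_real_derivative p1 x) (at x)"
    and p1: "(p1 has_real_derivative p2 x) (at x)"
    and p2: "(p2 has_real_derivative p3 x) (at x)"
    and cont_p3: "continuous_on UNIV p3"
    and periodic: "p (x + 2*pi) = p x"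
begin

lemma continuous [continuous_intros]:
  "continuous_on S p" "continuous_on S p1" "continuous_on S p2" "continuous_on S p3"
  using DERIV_isCont[OF p] DERIV_isCont[OF p1] DERIV_isCont[OF p2] cont_p3
  by (auto intro: continuous_at_imp_continuous_on continuous_on_subset)

lemma periodic_derivs: "p1 (x + 2*pi) = p1 x" "p2 (x + 2*pi) = p2 x"
proof -
  show 1: "p1 (x + 2*pi) = p1 x" for x by (rule derivative_periodic[of p], rule p, rule periodic)
  show "p2 (x + 2*pi) = p2 x" by (rule derivative_periodic[of p1], rule p1, rule 1)
qed

lemma periodic_ends: "p (2*pi) = p 0" "p1 (2*pi) = p1 0" "p2 (2*pi) = p2 0"
  using periodic[of 0] periodic_derivs[of 0] by simp_all

definition perimeter where "perimeter = circ (\<lambda>x. p x + p2 x)"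
definition encl_area where "encl_area = 1/2 * circ (\<lambda>x. (p x)\<^sup>2 - (p1 x)\<^sup>2)"
definition signed_evolute_area where "signed_evolute_area = 1/2 * circ (\<lambda>x. (p1 x)\<^sup>2 - (p2 x)\<^sup>2)"
definition radius_variance where "radius_variance = circ (\<lambda>x. (p x + p2 x - perimeter / (2*pi))\<^sup>2)"

text \<open>The isoperimetric deficit \<open>L\<^sup>2 - 4 \<pi> A\<close> divided by \<open>2 \<pi>\<close>. This normalization makes it equal to
  \<open>\<integral>g'\<^sup>2 - g\<^sup>2\<close> for the part \<open>g\<close> of \<open>p\<close> that has no harmonics of order below \<open>2\<close>.\<close>

definition deficit where "deficit = perimeter\<^sup>2 / (2*pi) - 2 * encl_area"

lemma perimeter_eq: "perimeter = circ p"
proof -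
  have "circ p2 = 0" using integral_of_derivative[OF p1, of 0 "2*pi"] by (simp add: periodic_ends)
  then show ?thesis unfolding perimeter_def by (simp add: circ_add continuous_intros)
qed

lemma square_deviation_integral:
  "circ (\<lambda>x. (p x + p2 x - c)\<^sup>2) = circ (\<lambda>x. (p x + p2 x)\<^sup>2) - 2 * c * perimeter + 2 * pi * c\<^sup>2"
proof -
  have "circ (\<lambda>x. (p x + p2 x - c)\<^sup>2) = circ (\<lambda>x. (p x + p2 x)\<^sup>2 - 2 * c * (p x + p2 x) + c\<^sup>2)"
    by (rule arg_cong[where f = circ], rule ext) (simp add: power2_eq_square algebra_simps)
  also have "\<dots> = circ (\<lambda>x. (p x + p2 x)\<^sup>2) - 2 * c * perimeter + 2 * pi * c\<^sup>2"
    by (simp add: circ_add circ_diff continuous_intros perimeter_def)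
  finally show ?thesis .
qed

lemma square_radius_integral: "circ (\<lambda>x. (p x + p2 x)\<^sup>2) = perimeter\<^sup>2 / (2*pi) + radius_variance"
  unfolding radius_variance_def square_deviation_integral by (simp add: power2_eq_square field_simps)

text \<open>The mean is the constant from which the mean square deviation is least, so any other constant \<open>c\<close> gives an upper
  bound. The midpoint of the range is the choice that is needed later.\<close>

lemma radius_variance_le:
  assumes "\<And>x. x \<in> {0..2*pi} \<Longrightarrow> \<bar>p x + p2 x - c\<bar> \<le> d"
  shows "radius_variance \<le> 2 * pi * d\<^sup>2"
proof -
  have "circ (\<lambda>x. (p x + p2 x - c)\<^sup>2) \<le> circ (\<lambda>_. d\<^sup>2)"
  proof (rule integral_le)
    show "(p x + p2 x - c)\<^sup>2 \<le> d\<^sup>2" if "x \<in> {0..2*pi}" for x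
      using power_mono[OF assms[OF that], of 2] by simp
  qed (auto intro!: continuous_integrable_circle continuous_intros)
  then have "circ (\<lambda>x. (p x + p2 x - c)\<^sup>2) \<le> 2 * pi * d\<^sup>2" by simp
  moreover have "circ (\<lambda>x. (p x + p2 x - c)\<^sup>2) = radius_variance + 2 * pi * (perimeter / (2*pi) - c)\<^sup>2"
    unfolding square_deviation_integral square_radius_integral by (simp add: power2_eq_square field_simps)
  moreover have "2 * pi * (perimeter / (2*pi) - c)\<^sup>2 \<ge> 0" by simp
  ultimately show ?thesis by linarith
qed

text \<open>\<open>p'' + p\<close> is orthogonal to the kernel of the self-adjoint operator \<open>u \<mapsto> u'' + u\<close>.\<close>

lemma harmonic_orthogonal:
  "circ (\<lambda>x. (p x + p2 x) * cos x) = 0" "circ (\<lambda>x. (p x + p2 x) * sin x) = 0"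
proof -
  have "circ (\<lambda>x. (p x + p2 x) * cos x) = (p1 (2*pi) * cos (2*pi) + p (2*pi) * sin (2*pi)) - (p1 0 * cos 0 + p 0 * sin 0)"
    by (rule integral_of_derivative) (auto intro!: derivative_eq_intros p p1 simp: algebra_simps)
  then show "circ (\<lambda>x. (p x + p2 x) * cos x) = 0" by (simp add: periodic_ends)
  have "circ (\<lambda>x. (p x + p2 x) * sin x) = (p1 (2*pi) * sin (2*pi) - p (2*pi) * cos (2*pi)) - (p1 0 * sin 0 - p 0 * cos 0)"
    by (rule integral_of_derivative) (auto intro!: derivative_eq_intros p p1 simp: algebra_simps)
  then show "circ (\<lambda>x. (p x + p2 x) * sin x) = 0" by (simp add: periodic_ends)
qed

text \<open>\<open>g\<close> is \<open>p\<close> without its Fourier modes of order \<open>0\<close> and \<open>1\<close>, and \<open>f = g + g''\<close> is the curvature radius minus its mean.\<close>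

definition mean_radius where "mean_radius = perimeter / (2*pi)"
definition ca where "ca = circ (\<lambda>x. p x * cos x) / pi"
definition cb where "cb = circ (\<lambda>x. p x * sin x) / pi"
definition g where "g x = p x - mean_radius - (ca * cos x + cb * sin x)"
definition g1 where "g1 x = p1 x - (cb * cos x - ca * sin x)"
definition f where "f x = p x + p2 x - mean_radius"

lemma g_deriv: "(g has_real_derivative g1 x) (at x)"
  unfolding g_def g1_def by (auto intro!: derivative_eq_intros p)

lemma g1_deriv: "(g1 has_real_derivative f x - g x) (at x)"
  unfolding g_def g1_def f_def by (auto intro!: derivative_eq_intros p1)

lemma f_deriv: "(f has_real_derivative p1 x + p3 x) (at x)"
  unfolding f_def by (auto intro!: derivative_eq_intros p p2)

lemma fg_continuous [continuous_intros]: "continuous_on S f" "continuous_on S g" "continuous_on S g1"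
  unfolding f_def g_def g1_def by (intro continuous_intros)+

lemma fg_ends: "g (2*pi) = g 0" "g1 (2*pi) = g1 0"
  by (simp_all add: g_def g1_def periodic_ends)

lemma trig_squares: "circ (\<lambda>x. cos x * cos x) = pi" "circ (\<lambda>x. sin x * sin x) = pi" "circ (\<lambda>x. cos x * sin x) = 0"
proof -
  have 1: "circ (\<lambda>x. cos x * sin x) = sin (2*pi) ^ 2 / 2 - sin 0 ^ 2 / 2"
    by (rule integral_of_derivative) (auto intro!: derivative_eq_intros)
  then show "circ (\<lambda>x. cos x * sin x) = 0" by simp
  have 2: "circ (\<lambda>x. cos x * cos x) = (2*pi + sin (2*pi) * cos (2*pi)) / 2 - (0 + sin 0 * cos 0) / 2"
    by (rule integral_of_derivative)
       (auto intro!: derivative_eq_intros simp: sin_squared_eq power2_eq_square[symmetric] field_simps)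
  then show 3: "circ (\<lambda>x. cos x * cos x) = pi" by simp
  have "(\<lambda>x::real. sin x * sin x) = (\<lambda>x. 1 - cos x * cos x)"
    by (simp add: sin_squared_eq power2_eq_square[symmetric])
  then show "circ (\<lambda>x. sin x * sin x) = pi"
    using 3 by (simp add: circ_diff continuous_intros)
qed

lemma g_orthogonal: "circ g = 0" "circ (\<lambda>x. g x * cos x) = 0" "circ (\<lambda>x. g x * sin x) = 0"
proof -
  show "circ g = 0"
    unfolding g_def by (simp add: circ_diff circ_add continuous_intros circ_cos_sin mean_radius_def perimeter_eq)
  have "(\<lambda>x. g x * cos x) = (\<lambda>x. p x * cos x - mean_radius * cos x - (ca * (cos x * cos x) + cb * (cos x * sin x)))"
    by (auto simp: g_def algebra_simps)
  then show "circ (\<lambda>x. g x * cos x) = 0"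
    by (simp add: circ_diff circ_add continuous_intros circ_cos_sin trig_squares ca_def)
  have "(\<lambda>x. g x * sin x) = (\<lambda>x. p x * sin x - mean_radius * sin x - (ca * (cos x * sin x) + cb * (sin x * sin x)))"
    by (auto simp: g_def algebra_simps)
  then show "circ (\<lambda>x. g x * sin x) = 0"
    by (simp add: circ_diff circ_add continuous_intros circ_cos_sin trig_squares cb_def)
qed

lemma f_orthogonal: "circ f = 0" "circ (\<lambda>x. f x * cos x) = 0" "circ (\<lambda>x. f x * sin x) = 0"
proof -
  show "circ f = 0"
    unfolding f_def by (simp add: circ_diff continuous_intros mean_radius_def perimeter_def)
  show "circ (\<lambda>x. f x * cos x) = 0" "circ (\<lambda>x. f x * sin x) = 0"
    unfolding f_def left_diff_distrib
    by (simp_all add: circ_diff continuous_intros harmonic_orthogonal circ_cos_sin)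
qed

lemma encl_area_eq: "2 * encl_area = circ (\<lambda>x. p x * (p x + p2 x))"
proof -
  have "circ (\<lambda>x. p1 x * p1 x) = - circ (\<lambda>x. p x * p2 x)"
    using periodic_ends by (intro circ_by_parts p p1) (auto intro!: continuous_intros)
  then show ?thesis
    unfolding encl_area_def by (simp add: circ_diff circ_add continuous_intros power2_eq_square distrib_left)
qed

text \<open>Decompose both factors of \<open>p (p + p'')\<close>, whose integral is twice the area: the first is the mean plus first harmonics plus \<open>g\<close>, the
  second is the mean plus \<open>f\<close>, and \<open>f\<close> is orthogonal to the mean and to the first harmonics.\<close>

lemma deficit_eq: "deficit = - circ (\<lambda>x. f x * g x)"
proof -
  have "2 * encl_area = circ (\<lambda>x. mean_radius * p x + (mean_radius * f x + (ca * (f x * cos x) + cb * (f x * sin x)) + f x * g x))"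
    unfolding encl_area_eq by (rule arg_cong[where f = circ], rule ext) (simp add: f_def g_def algebra_simps)
  also have "\<dots> = mean_radius * perimeter + circ (\<lambda>x. f x * g x)"
    by (simp add: circ_add continuous_intros f_orthogonal perimeter_eq)
  also have "mean_radius * perimeter = perimeter\<^sup>2 / (2*pi)" by (simp add: mean_radius_def power2_eq_square)
  finally show ?thesis by (simp add: deficit_def)
qed

lemma radius_variance_eq: "radius_variance = circ (\<lambda>x. (f x)\<^sup>2)"
  by (simp add: radius_variance_def f_def mean_radius_def)

text \<open>The same decomposition of \<open>p'' (p + p'')\<close>; it shows that the evolute always encloses a nonpositive signed area.\<close>

lemma signed_evolute_area_eq: "- 2 * signed_evolute_area = radius_variance + deficit"
proof -
  have "circ (\<lambda>x. p1 x * p1 x) = - circ (\<lambda>x. p x * p2 x)"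
    using periodic_ends by (intro circ_by_parts p p1) (auto intro!: continuous_intros)
  then have "- 2 * signed_evolute_area = circ (\<lambda>x. p x * p2 x) + circ (\<lambda>x. p2 x * p2 x)"
    unfolding signed_evolute_area_def by (simp add: circ_diff continuous_intros power2_eq_square)
  also have "\<dots> = circ (\<lambda>x. p x * p2 x + p2 x * p2 x)"
    by (simp add: circ_add continuous_intros)
  also have "\<dots> = circ (\<lambda>x. mean_radius * p2 x + ((f x)\<^sup>2 - (ca * (f x * cos x) + cb * (f x * sin x)) - f x * g x))"
    by (rule arg_cong[where f = circ], rule ext) (simp add: f_def g_def power2_eq_square algebra_simps)
  also have "\<dots> = mean_radius * circ p2 + radius_variance + deficit"
    by (simp add: circ_add circ_diff continuous_intros f_orthogonal deficit_eq radius_variance_eq)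
  also have "circ p2 = 0" using integral_of_derivative[OF p1, of 0 "2*pi"] by (simp add: periodic_ends)
  finally show ?thesis by simp
qed

text \<open>The right-hand side is what the line integral of the enclosed area along the evolute evaluates to.\<close>

lemma signed_evolute_area_eq_evolute: "signed_evolute_area = 1/2 * circ (\<lambda>x. p1 x * (p1 x + p3 x))"
proof -
  have "circ (\<lambda>x. p2 x * p2 x) = - circ (\<lambda>x. p1 x * p3 x)"
    using periodic_ends by (intro circ_by_parts p1 p2) (auto intro!: continuous_intros)
  then show ?thesis
    unfolding signed_evolute_area_def by (simp add: circ_diff circ_add continuous_intros power2_eq_square distrib_left)
qed

lemma four_radius_variance_le: "4 * radius_variance \<le> circ (\<lambda>x. (p1 x + p3 x)\<^sup>2)"
  unfolding radius_variance_eq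
proof (rule wirtinger_second_order[OF f_deriv])
  show "f (x + 2*pi) = f x" for x by (simp add: f_def periodic periodic_derivs)
qed (auto intro!: continuous_intros f_orthogonal)

lemma deficit_ge: "3 * circ (\<lambda>x. (g x)\<^sup>2) \<le> deficit"
proof -
  have "4 * circ (\<lambda>x. (g x)\<^sup>2) \<le> circ (\<lambda>x. (g1 x)\<^sup>2)"
  proof (rule wirtinger_second_order[OF g_deriv])
    show "g (x + 2*pi) = g x" for x by (simp add: g_def periodic)
  qed (auto intro!: continuous_intros g_orthogonal)
  moreover have "circ (\<lambda>x. g1 x * g1 x) = - circ (\<lambda>x. g x * (f x - g x))"
    using fg_ends by (intro circ_by_parts g_deriv g1_deriv) (auto intro!: continuous_intros)
  moreover have "circ (\<lambda>x. g x * (f x - g x)) = circ (\<lambda>x. f x * g x - (g x)\<^sup>2)"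
    by (simp add: algebra_simps power2_eq_square)
  ultimately show ?thesis by (simp add: circ_diff continuous_intros deficit_eq power2_eq_square)
qed

lemma deficit_nonneg: "deficit \<ge> 0"
  using deficit_ge circ_nonneg[of "\<lambda>x. (g x)\<^sup>2"] by simp

text \<open>In Fourier coefficients this is \<open>(k\<^sup>2 - 1)\<^sup>2 \<ge> 3 (k\<^sup>2 - 1)\<close> for \<open>k \<ge> 2\<close>. Without coefficients: the second harmonics satisfy
  \<open>f + 3 g = 0\<close>, which suggests to expand \<open>\<integral>(f + 3 g)\<^sup>2 \<ge> 0\<close>; the mixed term is \<open>- 6 E\<close>, and \<open>9 \<integral>g\<^sup>2 \<le> 3 E\<close>.\<close>

lemma three_deficit_le: "3 * deficit \<le> radius_variance"
proof -
  have "0 \<le> circ (\<lambda>x. (f x + 3 * g x)\<^sup>2)" by (rule circ_nonneg) simp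
  also have "(\<lambda>x. (f x + 3 * g x)\<^sup>2) = (\<lambda>x. (f x)\<^sup>2 + 6 * (f x * g x) + 9 * (g x)\<^sup>2)"
    by (simp add: power2_eq_square algebra_simps)
  also have "circ \<dots> = radius_variance - 6 * deficit + 9 * circ (\<lambda>x. (g x)\<^sup>2)"
    by (simp add: circ_add continuous_intros deficit_eq radius_variance_eq)
  finally show ?thesis using deficit_ge by simp
qed

lemma deficit_zero:
  assumes "deficit \<le> 0"
  shows "p x = mean_radius + (ca * cos x + cb * sin x)"
proof -
  obtain k :: int where k: "0 \<le> x + 2 * pi * of_int k" "x + 2 * pi * of_int k < 0 + 2 * pi"
    by (rule periodic_reduce)
  have "(g (x + 2 * pi * of_int k))\<^sup>2 = 0"
    using circ_pos_zero[of "\<lambda>x. (g x)\<^sup>2"] deficit_ge assms k by (simp add: continuous_intros)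
  moreover have "g (x + 2 * pi * of_int k) = g x"
    by (rule periodic_int_shift) (simp add: g_def periodic)
  ultimately show ?thesis by (simp add: g_def)
qed

end

section \<open>Bonnesen's inequality\<close>

text \<open>The greatest zero in \<open>{z..z + \<pi>}\<close> is different from \<open>z\<close>: if there were no zero in \<open>{z<..z + \<pi>}\<close>, then \<open>q\<close> would not vanish
  near \<open>z + \<pi>\<close> either, and the interval \<open>{z + e..z + e + \<pi>}\<close> would contain no zero for small \<open>e > 0\<close>.\<close>

lemma next_zero:
  fixes q :: "real \<Rightarrow> real"
  assumes q: "continuous_on UNIV q" and half: "\<And>a. \<exists>t\<in>{a..a+pi}. q t = 0"
  obtains z' where "z < z'" "z' \<le> z + pi" "q z' = 0" "\<And>y. z' < y \<Longrightarrow> y \<le> z + pi \<Longrightarrow> q y \<noteq> 0"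
proof (cases "q (z + pi) = 0")
  case True
  with that[of "z + pi"] show ?thesis by simp
next
  case False
  have "isCont q (z + pi)" using q by (simp add: continuous_on_eq_continuous_at)
  then obtain d where d: "d > 0" "\<And>y. dist y (z + pi) < d \<Longrightarrow> q y \<noteq> 0"
    using continuous_at_avoid[of "z + pi" q 0] False by (metis dist_commute)
  define e where "e = d / 2"
  have e: "e > 0" "\<And>y. z + pi \<le> y \<Longrightarrow> y \<le> z + pi + e \<Longrightarrow> q y \<noteq> 0"
    using d by (auto simp: e_def dist_real_def)
  define Z where "Z = {z + e..z + pi} \<inter> {t. q t = 0}"
  have "closed {t. q t = 0}" by (rule closed_Collect_eq) (auto intro: q continuous_on_const)
  then have "compact Z" unfolding Z_def by (intro compact_Int_closed compact_Icc)
  moreover have "Z \<noteq> {}"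
  proof -
    obtain t where t: "z + e \<le> t" "t \<le> z + e + pi" "q t = 0" using half[of "z + e"] by auto
    have "t \<le> z + pi" using e(2)[of t] t by (cases "t \<le> z + pi") auto
    then show ?thesis using t by (auto simp: Z_def)
  qed
  ultimately obtain z' where z': "z' \<in> Z" "\<And>y. y \<in> Z \<Longrightarrow> y \<le> z'"
    using compact_attains_sup[of Z] by blast
  show ?thesis
  proof (rule that[of z'])
    show "z < z'" "z' \<le> z + pi" "q z' = 0" using z'(1) e(1) by (auto simp: Z_def)
    fix y assume y: "z' < y" "y \<le> z + pi"
    show "q y \<noteq> 0"
    proof
      assume "q y = 0"
      then have "y \<in> Z" using y z'(1) by (auto simp: Z_def)
      then show False using z'(2) y by force
    qed
  qed
qed

text \<open>Starting from a zero \<open>z0\<close>, go twice to the farthest zero within distance \<open>\<pi>\<close>. By maximality the second step passes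
  \<open>z0 + \<pi>\<close>, so the way back to \<open>z0 + 2 \<pi>\<close> is at most \<open>\<pi>\<close>, and the circle is covered by three arcs on which Wirtinger's inequality with
  \<open>w = 1\<close> applies. The sign of \<open>q\<close> makes its zeros critical points, which settles the case of equality even for an arc of length \<open>\<pi>\<close>.\<close>

lemma wirtinger_contact:
  fixes q q1 :: "real \<Rightarrow> real"
  assumes q: "\<And>x. (q has_real_derivative q1 x) (at x)" and q1: "continuous_on UNIV q1"
    and per: "\<And>x. q (x + 2*pi) = q x" and neg: "\<And>x. q x \<le> 0"
    and half: "\<And>a. \<exists>t\<in>{a..a+pi}. q t = 0"
  shows "circ (\<lambda>x. (q1 x)\<^sup>2 - (q x)\<^sup>2) \<ge> 0"
    and "circ (\<lambda>x. (q1 x)\<^sup>2 - (q x)\<^sup>2) = 0 \<Longrightarrow> q x = 0"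
proof -
  have cq: "continuous_on UNIV q"
    using DERIV_isCont[OF q] by (auto simp: continuous_on_eq_continuous_at)
  have "continuous_on UNIV (\<lambda>x. (q1 x)\<^sup>2 - (q x)\<^sup>2)" by (intro continuous_intros q1 cq)
  then obtain P where P: "\<And>x. (P has_real_derivative (q1 x)\<^sup>2 - (q x)\<^sup>2) (at x)"
    using continuous_primitive by blast
  have crit: "q1 z = 0" if "q z = 0" for z
    using DERIV_local_max[OF q[of z], of 1] neg that by simp
  have step: "P u \<le> P v \<and> (P u = P v \<longrightarrow> (\<forall>y\<in>{u..v}. q y = 0))"
    if "u \<le> v" "v \<le> u + pi" "q u = 0" "q v = 0" for u v
  proof (cases "u = v")
    case True
    then show ?thesis using that by auto
  next
    case False
    then have uv: "u < v" "(1::real) * (v - u) \<le> pi" using that by auto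
    have I: "integral {u..v} (\<lambda>x. (q1 x)\<^sup>2 - 1\<^sup>2 * (q x)\<^sup>2) = P v - P u"
      using integral_of_derivative[OF P, of u v] that by simp
    have "P u \<le> P v"
      using wirtinger_dirichlet(1)[OF uv(1) zero_less_one uv(2) q q1 that(3,4)] unfolding I by linarith
    moreover have "q y = 0" if "P u = P v" "y \<in> {u..v}" for y
      using wirtinger_dirichlet_equality[OF uv(1) zero_less_one uv(2) q q1 \<open>q u = 0\<close> \<open>q v = 0\<close> crit, of y]
        that \<open>q u = 0\<close> unfolding I by simp
    ultimately show ?thesis by blast
  qed
  obtain z0 where z0: "q z0 = 0" using half by blast
  obtain z1 where z1: "z0 < z1" "z1 \<le> z0 + pi" "q z1 = 0" "\<And>y. z1 < y \<Longrightarrow> y \<le> z0 + pi \<Longrightarrow> q y \<noteq> 0"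
    using next_zero[OF cq half, of z0] by blast
  obtain z2 where z2: "z1 < z2" "z2 \<le> z1 + pi" "q z2 = 0"
    using next_zero[OF cq half, of z1] by blast
  have z2': "z0 + pi < z2" using z1(4)[of z2] z2 by force
  have z3: "q (z0 + 2*pi) = 0" using z0 per by simp
  have s1: "P z0 \<le> P z1 \<and> (P z0 = P z1 \<longrightarrow> (\<forall>y\<in>{z0..z1}. q y = 0))"
    by (rule step) (use z0 z1 in auto)
  have s2: "P z1 \<le> P z2 \<and> (P z1 = P z2 \<longrightarrow> (\<forall>y\<in>{z1..z2}. q y = 0))"
    by (rule step) (use z1 z2 in auto)
  have s3: "P z2 \<le> P (z0 + 2*pi) \<and> (P z2 = P (z0 + 2*pi) \<longrightarrow> (\<forall>y\<in>{z2..z0 + 2*pi}. q y = 0))"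
    by (rule step) (use z1 z2 z2' z3 in auto)
  have per1: "q1 (x + 2*pi) = q1 x" for x
    by (rule derivative_periodic[of q], rule q, rule per)
  have "P (z0 + 2*pi) - P z0 = integral {z0..z0+2*pi} (\<lambda>x. (q1 x)\<^sup>2 - (q x)\<^sup>2)"
    using integral_of_derivative[OF P, of z0 "z0 + 2*pi"] by simp
  also have "\<dots> = circ (\<lambda>x. (q1 x)\<^sup>2 - (q x)\<^sup>2)"
    by (rule integral_periodic_shift) (auto intro!: continuous_intros q1 cq simp: per per1)
  finally have I: "circ (\<lambda>x. (q1 x)\<^sup>2 - (q x)\<^sup>2) = P (z0 + 2*pi) - P z0" by simp
  show "circ (\<lambda>x. (q1 x)\<^sup>2 - (q x)\<^sup>2) \<ge> 0" using s1 s2 s3 I by simp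
  assume "circ (\<lambda>x. (q1 x)\<^sup>2 - (q x)\<^sup>2) = 0"
  then have eq: "P z0 = P z1" "P z1 = P z2" "P z2 = P (z0 + 2*pi)" using s1 s2 s3 I by linarith+
  have all: "q y = 0" if y: "z0 \<le> y" "y \<le> z0 + 2*pi" for y
  proof -
    have "y \<in> {z0..z1} \<or> y \<in> {z1..z2} \<or> y \<in> {z2..z0 + 2*pi}"
      unfolding atLeastAtMost_iff using y by linarith
    then show ?thesis
      using mp[OF conjunct2[OF s1] eq(1)] mp[OF conjunct2[OF s2] eq(2)] mp[OF conjunct2[OF s3] eq(3)]
      by (elim disjE) (erule (1) bspec)+
  qed
  obtain k :: int where "z0 \<le> x + 2 * pi * of_int k" "x + 2 * pi * of_int k < z0 + 2 * pi"
    by (rule periodic_reduce)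
  then have "q (x + 2 * pi * of_int k) = 0" by (intro all) simp_all
  then show "q x = 0" using periodic_int_shift[of q x k, OF per] by simp
qed

context smooth_periodic
begin

text \<open>The right-hand side is the support function of the disk with radius \<open>s\<close> and centre \<open>(a, b)\<close>; the radius \<open>s\<close> may be negative.\<close>

definition circumscribable :: "real \<Rightarrow> bool" where
  "circumscribable s \<longleftrightarrow> (\<exists>a b. \<forall>x. p x \<le> s + (a * cos x + b * sin x))"

text \<open>Compactness: if \<open>\<bar>p\<bar> \<le> B\<close>, only radii in \<open>{-B..B}\<close> matter, and the inequality in the four axis directions then bounds the centre.\<close>

lemma least_circumscribable:
  obtains R where "circumscribable R" "\<And>s. circumscribable s \<Longrightarrow> R \<le> s"
proof -
  have "compact (p ` {0..2*pi})" by (intro compact_continuous_image continuous compact_Icc)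
  then obtain B where B: "\<And>y. y \<in> p ` {0..2*pi} \<Longrightarrow> \<bar>y\<bar> \<le> B"
    using compact_imp_bounded bounded_real by metis
  have pB: "\<bar>p x\<bar> \<le> B" for x
  proof -
    obtain k :: int where "0 \<le> x + 2 * pi * of_int k" "x + 2 * pi * of_int k < 0 + 2 * pi"
      by (rule periodic_reduce)
    then have "\<bar>p (x + 2 * pi * of_int k)\<bar> \<le> B" by (intro B imageI) simp
    then show ?thesis using periodic_int_shift[of p x k, OF periodic] by simp
  qed
  define T where "T = ({-B..B} \<times> ({-2*B..2*B} \<times> {-2*B..2*B})) \<inter>
     {z. \<forall>x. p x \<le> fst z + (fst (snd z) * cos x + snd (snd z) * sin x)}"
  have bound: "(s, a, b) \<in> {-B..B} \<times> ({-2*B..2*B} \<times> {-2*B..2*B})"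
    if s: "s \<le> B" and le: "\<And>x. p x \<le> s + (a * cos x + b * sin x)" for s a b
  proof -
    show ?thesis
      using trig_three_quarters le[of 0] le[of pi] le[of "pi/2"] le[of "3*pi/2"] s
        pB[of 0] pB[of pi] pB[of "pi/2"] pB[of "3*pi/2"]
      by (auto simp: abs_le_iff)
  qed
  have "closed {z::real \<times> real \<times> real. \<forall>x. p x \<le> fst z + (fst (snd z) * cos x + snd (snd z) * sin x)}"
    by (intro closed_Collect_all closed_Collect_le continuous_intros)
  then have "compact T" unfolding T_def
    by (intro compact_Int_closed compact_Times compact_Icc)
  moreover have "(B, 0, 0) \<in> T"
    using bound[of B 0 0] pB by (auto simp: T_def abs_le_iff)
  moreover have "continuous_on T fst" by (intro continuous_intros)
  ultimately obtain m where m: "m \<in> T" "\<And>z. z \<in> T \<Longrightarrow> fst m \<le> fst z"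
    using continuous_attains_inf[of T fst] by blast
  show ?thesis
  proof
    show "circumscribable (fst m)" using m(1) by (auto simp: T_def circumscribable_def)
    fix s assume "circumscribable s"
    then obtain a b where ab: "\<And>x. p x \<le> s + (a * cos x + b * sin x)" by (auto simp: circumscribable_def)
    have "fst m \<le> B" using m(1) by (auto simp: T_def)
    moreover have "fst m \<le> s" if "s \<le> B"
      using m(2)[of "(s, a, b)"] bound[OF that ab] ab by (auto simp: T_def)
    ultimately show "fst m \<le> s" by linarith
  qed
qed

text \<open>Suppose that the support function of the disk is not attained by \<open>p\<close> in the half circle of directions that starts at \<open>v\<close>. Then
  the disk can be moved a little away from these directions, along \<open>- (cos (v + \<pi>/2), sin (v + \<pi>/2))\<close>, after which there is no contact at all, and a smaller radius
  suffices.\<close>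

lemma contact_half_circle:
  assumes R: "\<And>s. circumscribable s \<Longrightarrow> R \<le> s" and ab: "\<And>x. p x \<le> R + (a * cos x + b * sin x)"
  shows "\<exists>t\<in>{v..v+pi}. p t = R + (a * cos t + b * sin t)"
proof (rule ccontr)
  assume none: "\<not> ?thesis"
  define q where "q t = p t - R - (a * cos t + b * sin t)" for t
  have cq: "continuous_on S q" for S unfolding q_def by (intro continuous_intros)
  obtain t0 where t0: "t0 \<in> {v..v+pi}" "\<And>t. t \<in> {v..v+pi} \<Longrightarrow> q t \<le> q t0"
    using continuous_attains_sup[of "{v..v+pi}" q] cq by auto
  define \<epsilon> where "\<epsilon> = - q t0"
  have "p t0 \<noteq> R + (a * cos t0 + b * sin t0)" using none t0(1) by blast
  then have "q t0 \<noteq> 0" by (simp add: q_def)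
  then have \<epsilon>: "\<epsilon> > 0" using ab[of t0] by (simp add: \<epsilon>_def q_def)
  \<comment> \<open>On the half circle \<open>q \<le> - \<epsilon>\<close>, so that adding at most \<open>\<epsilon> / 2\<close> leaves it negative; on the open complementary half
    circle \<open>q \<le> 0\<close> and the sine is negative.\<close>
  define w where "w t = q t + \<epsilon> / 2 * sin (t - v)" for t
  have cw: "continuous_on S w" for S unfolding w_def by (intro continuous_intros cq)
  have neg: "w t < 0" if "v \<le> t" "t \<le> v + 2*pi" for t
  proof (cases "t \<le> v + pi")
    case True
    have "\<epsilon> / 2 * sin (t - v) \<le> \<epsilon> / 2 * 1" using \<epsilon> by (intro mult_left_mono) auto
    moreover have "q t \<le> - \<epsilon>" using t0(2)[of t] that True by (simp add: \<epsilon>_def)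
    ultimately show ?thesis using \<epsilon> unfolding w_def by linarith
  next
    case False
    show ?thesis
    proof (cases "t = v + 2*pi")
      case True
      have "q t = q v" using True periodic[of v] by (simp add: q_def)
      moreover have "q v < 0" using t0(2)[of v] \<epsilon> by (simp add: \<epsilon>_def)
      ultimately show ?thesis using True by (simp add: w_def)
    next
      case 2: False
      have "sin (t - v) < 0" using sin_lt_zero[of "t - v"] that False 2 by simp
      then have "\<epsilon> / 2 * sin (t - v) < 0" using \<epsilon> by (simp add: mult_pos_neg)
      moreover have "q t \<le> 0" using ab[of t] by (simp add: q_def)
      ultimately show ?thesis by (simp add: w_def)
    qed
  qed
  obtain t1 where t1: "t1 \<in> {v..v+2*pi}" "\<And>t. t \<in> {v..v+2*pi} \<Longrightarrow> w t \<le> w t1"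
    using continuous_attains_sup[of "{v..v+2*pi}" w] cw by auto
  have w_le: "w t \<le> w t1" for t
  proof -
    obtain k :: int where k: "v \<le> t + 2 * pi * of_int k" "t + 2 * pi * of_int k < v + 2 * pi"
      by (rule periodic_reduce)
    have "w (t + 2*pi) = w t" for t
    proof -
      have "sin (t + 2*pi - v) = sin (t - v)"
        using sin_periodic[of "t - v"] by (simp add: algebra_simps)
      then show ?thesis by (simp add: w_def q_def periodic)
    qed
    then have "w (t + 2 * pi * of_int k) = w t" by (rule periodic_int_shift)
    then show ?thesis using t1(2)[of "t + 2 * pi * of_int k"] k by simp
  qed
  have "circumscribable (R + w t1)"
    unfolding circumscribable_def
  proof (intro exI allI)
    show "p t \<le> R + w t1 + ((a + \<epsilon> / 2 * sin v) * cos t + (b - \<epsilon> / 2 * cos v) * sin t)" for t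
      using w_le[of t] by (simp add: w_def q_def sin_diff algebra_simps)
  qed
  then show False using R neg[of t1] t1(1) by force
qed

text \<open>The polynomial in \<open>R\<close> is the area functional \<open>1/2 \<integral>q\<^sup>2 - q'\<^sup>2\<close> of the difference \<open>q\<close> between \<open>p\<close> and the
  support function of the disk.\<close>

lemma least_circumscribable_root:
  assumes R: "\<And>s. circumscribable s \<Longrightarrow> R \<le> s" and ab: "\<And>x. p x \<le> R + (a * cos x + b * sin x)"
  shows "encl_area - perimeter * R + pi * R\<^sup>2 \<le> 0"
    and "encl_area - perimeter * R + pi * R\<^sup>2 = 0 \<Longrightarrow> p x = R + (a * cos x + b * sin x)"
proof -
  define q where "q x = p x - R - (a * cos x + b * sin x)" for x
  define q1 where "q1 x = p1 x - (b * cos x - a * sin x)" for x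
  have q: "(q has_real_derivative q1 x) (at x)" for x
    unfolding q_def q1_def by (auto intro!: derivative_eq_intros p)
  have q1: "(q1 has_real_derivative (p x + p2 x) - R - q x) (at x)" for x
    unfolding q_def q1_def by (auto intro!: derivative_eq_intros p1)
  have cq: "continuous_on UNIV q" "continuous_on UNIV q1"
    unfolding q_def q1_def by (intro continuous_intros)+
  have "circ (\<lambda>x. q1 x * q1 x) = - circ (\<lambda>x. q x * ((p x + p2 x) - R - q x))"
    by (intro circ_by_parts q q1) (auto intro!: continuous_intros cq simp: q_def q1_def periodic_ends)
  then have "circ (\<lambda>x. (q1 x)\<^sup>2 - (q x)\<^sup>2) = - circ (\<lambda>x. q x * ((p x + p2 x) - R - q x) + (q x)\<^sup>2)"
    by (simp add: circ_add circ_diff continuous_intros cq power2_eq_square)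
  also have "(\<lambda>x. q x * ((p x + p2 x) - R - q x) + (q x)\<^sup>2) =
      (\<lambda>x. p x * (p x + p2 x) - R * (p x + p2 x) - (a * ((p x + p2 x) * cos x) + b * ((p x + p2 x) * sin x))
        - R * p x + (R\<^sup>2 + (R * a) * cos x + (R * b) * sin x))"
    by (rule ext) (simp add: q_def power2_eq_square algebra_simps)
  also have "circ \<dots> = 2 * encl_area - R * perimeter - R * perimeter + 2 * pi * R\<^sup>2"
  proof -
    have trig: "circ (\<lambda>x. a * ((p x + p2 x) * cos x) + b * ((p x + p2 x) * sin x)) = 0"
    proof -
      have "circ (\<lambda>x. a * ((p x + p2 x) * cos x) + b * ((p x + p2 x) * sin x)) =
        circ (\<lambda>x. a * ((p x + p2 x) * cos x)) + circ (\<lambda>x. b * ((p x + p2 x) * sin x))"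
        by (intro circ_add continuous_intros)
      then show ?thesis by (simp add: harmonic_orthogonal)
    qed
    have const: "circ (\<lambda>x. R\<^sup>2 + (R * a) * cos x + (R * b) * sin x) = 2 * pi * R\<^sup>2"
      by (simp add: circ_add continuous_intros circ_cos_sin)
    have linear: "circ (\<lambda>x. A x - B x - C x - D x + E x) = circ A - circ B - circ C - circ D + circ E"
      if "continuous_on UNIV A" "continuous_on UNIV B" "continuous_on UNIV C" "continuous_on UNIV D"
        "continuous_on UNIV E" for A B C D E
      using that by (simp add: circ_add circ_diff continuous_intros)
    show ?thesis
      by (subst linear, (intro continuous_intros)+)
         (simp only: trig const encl_area_eq[symmetric] perimeter_def[symmetric] perimeter_eq[symmetric] integral_mult_right)
  qed
  finally have I: "circ (\<lambda>x. (q1 x)\<^sup>2 - (q x)\<^sup>2) = - 2 * (encl_area - perimeter * R + pi * R\<^sup>2)"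
    by simp
  have "q t = 0 \<longleftrightarrow> p t = R + (a * cos t + b * sin t)" for t by (auto simp: q_def)
  then have half: "\<exists>t\<in>{v..v+pi}. q t = 0" for v
    using contact_half_circle[OF R ab, of v] by simp
  have "q x \<le> 0" "q (x + 2*pi) = q x" for x
    using ab[of x] by (simp_all add: q_def periodic)
  note contact = wirtinger_contact[OF q cq(2) this(2,1) half]
  show "encl_area - perimeter * R + pi * R\<^sup>2 \<le> 0" using contact(1) I by simp
  assume "encl_area - perimeter * R + pi * R\<^sup>2 = 0"
  then have "q x = 0" using contact(2) I by simp
  then show "p x = R + (a * cos x + b * sin x)" by (simp add: q_def)
qed

text \<open>As for the enclosing disks, but with the disk of radius \<open>s\<close> inside.\<close>

definition inscribable :: "real \<Rightarrow> bool" where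
  "inscribable s \<longleftrightarrow> (\<exists>a b. \<forall>x. s + (a * cos x + b * sin x) \<le> p x)"

text \<open>Inscribed disks of \<open>p\<close> correspond to enclosing disks of \<open>-p\<close> with negated radius and centre, and passing from \<open>p\<close> to \<open>-p\<close> negates the
  length and preserves the area; so the quadratic polynomial is the same.\<close>

lemma greatest_inscribable:
  obtains r where "inscribable r" "\<And>s. inscribable s \<Longrightarrow> s \<le> r" "encl_area - perimeter * r + pi * r\<^sup>2 \<le> 0"
proof -
  interpret n: smooth_periodic "\<lambda>x. - p x" "\<lambda>x. - p1 x" "\<lambda>x. - p2 x" "\<lambda>x. - p3 x"
    by unfold_locales (auto intro!: derivative_eq_intros p p1 p2 continuous_intros simp: periodic)
  have n_perimeter: "n.perimeter = - perimeter"
    by (simp add: n.perimeter_eq perimeter_eq)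
  have n_encl_area: "n.encl_area = encl_area" by (simp add: n.encl_area_def encl_area_def)
  have inscribable_iff: "n.circumscribable (- s) = inscribable s" for s
  proof
    assume "n.circumscribable (- s)"
    then obtain a b where "\<And>x. - p x \<le> - s + (a * cos x + b * sin x)" by (auto simp: n.circumscribable_def)
    then have "s + ((-a) * cos x + (-b) * sin x) \<le> p x" for x by (simp add: algebra_simps)
    then show "inscribable s" unfolding inscribable_def by blast
  next
    assume "inscribable s"
    then obtain a b where "\<And>x. s + (a * cos x + b * sin x) \<le> p x" by (auto simp: inscribable_def)
    then have "- p x \<le> - s + ((-a) * cos x + (-b) * sin x)" for x
      by (simp add: algebra_simps)
    then show "n.circumscribable (- s)" unfolding n.circumscribable_def by blast
  qed
  obtain m where m: "n.circumscribable m" "\<And>s. n.circumscribable s \<Longrightarrow> m \<le> s" using n.least_circumscribable by blast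
  obtain a b where "\<And>x. - p x \<le> m + (a * cos x + b * sin x)"
    using m(1) by (auto simp: n.circumscribable_def)
  note root = n.least_circumscribable_root(1)[OF m(2) this]
  show ?thesis
  proof (rule that[of "- m"])
    show "inscribable (- m)" using inscribable_iff[of "- m"] m(1) by simp
    show "s \<le> - m" if "inscribable s" for s using inscribable_iff[of s] m(2)[of "- s"] that by simp
    show "encl_area - perimeter * (- m) + pi * (- m)\<^sup>2 \<le> 0" using root by (simp add: n_perimeter n_encl_area)
  qed
qed

text \<open>Completing the square, \<open>4 \<pi> (A - L t + \<pi> t\<^sup>2) = (2 \<pi> t - L)\<^sup>2 - (L\<^sup>2 - 4 \<pi> A)\<close>. If this is nonpositive for \<open>t = R\<close> and \<open>t = r\<close>, then
  \<open>2 \<pi> (R - r)\<close> is at most twice the square root of the deficit, and equality requires that \<open>R\<close> is a root.\<close>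

lemma bonnesen:
  assumes "circumscribable R" and R: "\<And>s. circumscribable s \<Longrightarrow> R \<le> s"
    and r: "encl_area - perimeter * r + pi * r\<^sup>2 \<le> 0"
  shows "pi\<^sup>2 * (R - r)\<^sup>2 \<le> 2 * pi * deficit"
    and "pi\<^sup>2 * (R - r)\<^sup>2 = 2 * pi * deficit \<Longrightarrow> \<exists>a b. \<forall>x. p x = R + (a * cos x + b * sin x)"
proof -
  obtain a b where ab: "\<And>x. p x \<le> R + (a * cos x + b * sin x)" using assms(1) by (auto simp: circumscribable_def)
  define D where "D = 2 * pi * deficit"
  define X Y where "X = 2 * pi * R - perimeter" and "Y = 2 * pi * r - perimeter"
  have D: "D = perimeter\<^sup>2 - 4 * pi * encl_area" by (simp add: D_def deficit_def field_simps power2_eq_square)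
  have X: "X\<^sup>2 - D = 4 * pi * (encl_area - perimeter * R + pi * R\<^sup>2)"
    by (simp add: D X_def power2_eq_square algebra_simps)
  have Y: "Y\<^sup>2 - D = 4 * pi * (encl_area - perimeter * r + pi * r\<^sup>2)"
    by (simp add: D Y_def power2_eq_square algebra_simps)
  have X0: "X\<^sup>2 - D \<le> 0" unfolding X using least_circumscribable_root(1)[OF R ab] by (simp add: mult_le_0_iff)
  have Y0: "Y\<^sup>2 - D \<le> 0" unfolding Y using r by (simp add: mult_le_0_iff)
  have "4 * (pi\<^sup>2 * (R - r)\<^sup>2) = (X - Y)\<^sup>2"
    by (simp add: X_def Y_def power2_eq_square algebra_simps)
  also have "\<dots> = 2 * X\<^sup>2 + 2 * Y\<^sup>2 - (X + Y)\<^sup>2"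
    by (simp add: power2_eq_square algebra_simps)
  finally have *: "4 * (pi\<^sup>2 * (R - r)\<^sup>2) \<le> 2 * X\<^sup>2 + 2 * Y\<^sup>2" by simp
  then show "pi\<^sup>2 * (R - r)\<^sup>2 \<le> 2 * pi * deficit"
    using X0 Y0 unfolding D_def by linarith
  assume "pi\<^sup>2 * (R - r)\<^sup>2 = 2 * pi * deficit"
  then have "X\<^sup>2 - D = 0" using * X0 Y0 unfolding D_def by linarith
  then have "encl_area - perimeter * R + pi * R\<^sup>2 = 0" using X by simp
  then show "\<exists>a b. \<forall>x. p x = R + (a * cos x + b * sin x)"
    using least_circumscribable_root(2)[OF R ab] by blast
qed

end

section \<open>Positively curved closed curves and their normal angle\<close>

lemma second_derivative_at_maximum:
  fixes f f1 :: "real \<Rightarrow> real"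
  assumes f: "\<And>x. (f has_real_derivative f1 x) (at x)" and f1: "(f1 has_real_derivative d) (at t)"
    and max: "\<And>x. f x \<le> f t"
  shows "f1 t = 0" "d \<le> 0"
proof -
  show crit: "f1 t = 0" using DERIV_local_max[OF f[of t], of 1] max by simp
  show "d \<le> 0"
  proof (rule ccontr)
    assume "\<not> d \<le> 0"
    then obtain e where e: "e > 0" "\<And>h. h > 0 \<Longrightarrow> h < e \<Longrightarrow> f1 t < f1 (t + h)"
      using DERIV_pos_inc_right[OF f1] by auto
    obtain z where z: "t < z" "z < t + e/2" "f (t + e/2) - f t = (t + e/2 - t) * f1 z"
      using MVT2[of t "t + e/2" f f1] f e(1) by auto
    have "f1 z > 0" using e(2)[of "z - t"] z crit by simp
    then have "(t + e/2 - t) * f1 z > 0" using e(1) by simp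
    then show False using z(3) max[of "t + e/2"] by linarith
  qed
qed

text \<open>The coordinates of a closed curve and their first three derivatives. Positive curvature in particular makes the curve regular.\<close>

locale positively_curved =
  fixes x x1 x2 x3 y y1 y2 y3 :: "real \<Rightarrow> real" and T :: real
  assumes x: "(x has_real_derivative x1 t) (at t)" and x1: "(x1 has_real_derivative x2 t) (at t)"
    and x2: "(x2 has_real_derivative x3 t) (at t)" and x3: "continuous_on UNIV x3"
    and y: "(y has_real_derivative y1 t) (at t)" and y1: "(y1 has_real_derivative y2 t) (at t)"
    and y2: "(y2 has_real_derivative y3 t) (at t)" and y3: "continuous_on UNIV y3"
    and curved: "x1 t * y2 t - y1 t * x2 t > 0"
    and T: "T > 0" and periodic: "x (t + T) = x t" "y (t + T) = y t"
begin

lemma continuous [continuous_intros]: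
  "continuous_on A x" "continuous_on A x1" "continuous_on A x2" "continuous_on A x3"
  "continuous_on A y" "continuous_on A y1" "continuous_on A y2" "continuous_on A y3"
  using DERIV_isCont[OF x] DERIV_isCont[OF x1] DERIV_isCont[OF x2] x3
    DERIV_isCont[OF y] DERIV_isCont[OF y1] DERIV_isCont[OF y2] y3
  by (auto intro: continuous_at_imp_continuous_on continuous_on_subset)

definition speed where "speed t = sqrt ((x1 t)\<^sup>2 + (y1 t)\<^sup>2)"

text \<open>\<open>turn\<close> is the rate of rotation of the tangent, that is curvature times speed; \<open>stretch\<close> is the logarithmic derivative of the speed.\<close>

definition turn where "turn t = (x1 t * y2 t - y1 t * x2 t) / ((x1 t)\<^sup>2 + (y1 t)\<^sup>2)"
definition stretch where "stretch t = (x1 t * x2 t + y1 t * y2 t) / ((x1 t)\<^sup>2 + (y1 t)\<^sup>2)"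

lemma regular: "(x1 t)\<^sup>2 + (y1 t)\<^sup>2 > 0"
  using curved[of t] by (auto simp: sum_power2_gt_zero_iff)

lemma speed_pos: "speed t > 0" and speed_sq: "(speed t)\<^sup>2 = (x1 t)\<^sup>2 + (y1 t)\<^sup>2"
  using regular[of t] by (simp_all add: speed_def)

lemma turn_pos: "turn t > 0"
  using curved[of t] regular[of t] by (simp add: turn_def)

text \<open>The velocity and its rotation by \<open>\<pi>/2\<close> form an orthogonal basis; these are the coefficients of the acceleration in it.\<close>

lemma acceleration:
  "x2 t = stretch t * x1 t - turn t * y1 t" "y2 t = stretch t * y1 t + turn t * x1 t"
proof -
  define N where "N = (x1 t)\<^sup>2 + (y1 t)\<^sup>2"
  have N: "N \<noteq> 0" unfolding N_def using regular[of t] by linarith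
  have st: "stretch t * N = x1 t * x2 t + y1 t * y2 t" "turn t * N = x1 t * y2 t - y1 t * x2 t"
    using N by (simp_all add: stretch_def turn_def N_def)
  have "(stretch t * x1 t - turn t * y1 t) * N = (stretch t * N) * x1 t - (turn t * N) * y1 t"
    by (simp add: algebra_simps)
  also have "\<dots> = x2 t * N" unfolding st by (simp add: N_def power2_eq_square algebra_simps)
  finally show "x2 t = stretch t * x1 t - turn t * y1 t" using N by simp
  have "(stretch t * y1 t + turn t * x1 t) * N = (stretch t * N) * y1 t + (turn t * N) * x1 t"
    by (simp add: algebra_simps)
  also have "\<dots> = y2 t * N" unfolding st by (simp add: N_def power2_eq_square algebra_simps)
  finally show "y2 t = stretch t * y1 t + turn t * x1 t" using N by simp
qed

lemma speed_deriv: "(speed has_real_derivative stretch t * speed t) (at t)"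
proof -
  have "((\<lambda>t. (x1 t)\<^sup>2 + (y1 t)\<^sup>2) has_real_derivative 2 * (x1 t * x2 t + y1 t * y2 t)) (at t)"
    by (auto intro!: derivative_eq_intros x1 y1 simp: algebra_simps)
  then have "(speed has_real_derivative (inverse (speed t) / 2) * (2 * (x1 t * x2 t + y1 t * y2 t))) (at t)"
    unfolding speed_def using regular[of t] by (intro DERIV_chain2[OF DERIV_real_sqrt])
  moreover have "stretch t = (x1 t * x2 t + y1 t * y2 t) / (speed t)\<^sup>2"
    by (simp add: stretch_def speed_sq)
  then have "(inverse (speed t) / 2) * (2 * (x1 t * x2 t + y1 t * y2 t)) = stretch t * speed t"
    using speed_pos[of t] by (simp add: power2_eq_square field_simps)
  ultimately show ?thesis by simp
qed

lemma turn_deriv: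
  "(turn has_real_derivative ((x1 t * y3 t - y1 t * x3 t) - turn t * (2 * (x1 t * x2 t + y1 t * y2 t))) / ((x1 t)\<^sup>2 + (y1 t)\<^sup>2)) (at t)"
proof -
  have num: "((\<lambda>t. x1 t * y2 t - y1 t * x2 t) has_real_derivative x1 t * y3 t - y1 t * x3 t) (at t)"
    by (auto intro!: derivative_eq_intros x1 y1 x2 y2 simp: algebra_simps)
  have den: "((\<lambda>t. (x1 t)\<^sup>2 + (y1 t)\<^sup>2) has_real_derivative 2 * (x1 t * x2 t + y1 t * y2 t)) (at t)"
    by (auto intro!: derivative_eq_intros x1 y1 simp: algebra_simps)
  have pos: "(x1 t)\<^sup>2 + (y1 t)\<^sup>2 \<noteq> 0" using regular[of t] by linarith
  show ?thesis unfolding turn_def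
    by (rule DERIV_cong[OF DERIV_divide[OF num den pos]]) (use pos in \<open>simp add: divide_simps\<close>)
qed

lemma speed_turn_continuous [continuous_intros]: "continuous_on A speed" "continuous_on A turn"
  using DERIV_isCont[OF speed_deriv] DERIV_isCont[OF turn_deriv]
  by (auto intro: continuous_at_imp_continuous_on)

text \<open>Integrate the rate of rotation. In the frame that rotates with the resulting angle, the unit tangent has derivative zero, so it is
  constant, and the constant of integration is chosen such that the frame is aligned with the tangent at parameter \<open>0\<close>.\<close>

lemma tangent_angle:
  obtains \<phi> where "\<And>t. (\<phi> has_real_derivative turn t) (at t)"
    "\<And>t. x1 t = - speed t * sin (\<phi> t)" "\<And>t. y1 t = speed t * cos (\<phi> t)"
proof -
  obtain F where F: "\<And>t. (F has_real_derivative turn t) (at t)"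
    using continuous_primitive[OF speed_turn_continuous(2)] by blast
  have "(y1 0 / speed 0)\<^sup>2 + (- x1 0 / speed 0)\<^sup>2 = ((x1 0)\<^sup>2 + (y1 0)\<^sup>2) / (speed 0)\<^sup>2"
    by (simp add: power_divide add_divide_distrib)
  also have "\<dots> = 1" unfolding speed_sq[symmetric] using speed_pos[of 0] by simp
  finally obtain \<phi>0 where \<phi>0: "y1 0 / speed 0 = cos \<phi>0" "- x1 0 / speed 0 = sin \<phi>0"
    using sincos_total_2pi by metis
  define \<phi> where "\<phi> t = F t - F 0 + \<phi>0" for t
  have \<phi>: "(\<phi> has_real_derivative turn t) (at t)" for t
    unfolding \<phi>_def by (auto intro!: derivative_eq_intros F)
  define e where "e t = (x1 t * cos (\<phi> t) + y1 t * sin (\<phi> t)) / speed t" for t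
  define d where "d t = (y1 t * cos (\<phi> t) - x1 t * sin (\<phi> t)) / speed t" for t
  have "(e has_real_derivative 0) (at t)" for t
  proof -
    have n: "((\<lambda>t. x1 t * cos (\<phi> t) + y1 t * sin (\<phi> t)) has_real_derivative
        stretch t * (x1 t * cos (\<phi> t) + y1 t * sin (\<phi> t))) (at t)"
      by (auto intro!: derivative_eq_intros x1 y1 \<phi> simp: acceleration[of t] algebra_simps)
    show ?thesis unfolding e_def using speed_pos[of t]
      by (intro DERIV_cong[OF DERIV_divide[OF n speed_deriv]]) auto
  qed
  then have "e t = e 0" for t using DERIV_isconst_all by blast
  then have e: "x1 t * cos (\<phi> t) + y1 t * sin (\<phi> t) = 0" for t
  proof -
    have "e 0 = (x1 0 / speed 0) * cos \<phi>0 + (y1 0 / speed 0) * sin \<phi>0"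
      by (simp add: e_def \<phi>_def add_divide_distrib)
    also have "x1 0 / speed 0 = - sin \<phi>0" by (simp add: \<phi>0(2)[symmetric])
    also have "- sin \<phi>0 * cos \<phi>0 + (y1 0 / speed 0) * sin \<phi>0 = 0" unfolding \<phi>0(1) by simp
    finally have "e t = 0" using \<open>e t = e 0\<close> by simp
    then show ?thesis using speed_pos[of t] by (simp add: e_def)
  qed
  have "(d has_real_derivative 0) (at t)" for t
  proof -
    have n: "((\<lambda>t. y1 t * cos (\<phi> t) - x1 t * sin (\<phi> t)) has_real_derivative
        stretch t * (y1 t * cos (\<phi> t) - x1 t * sin (\<phi> t))) (at t)"
      by (auto intro!: derivative_eq_intros x1 y1 \<phi> simp: acceleration[of t] algebra_simps)
    show ?thesis unfolding d_def using speed_pos[of t]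
      by (intro DERIV_cong[OF DERIV_divide[OF n speed_deriv]]) auto
  qed
  then have "d t = d 0" for t using DERIV_isconst_all by blast
  then have d: "y1 t * cos (\<phi> t) - x1 t * sin (\<phi> t) = speed t" for t
  proof -
    have "d 0 = (y1 0 / speed 0) * cos \<phi>0 + (- x1 0 / speed 0) * sin \<phi>0"
      by (simp add: d_def \<phi>_def diff_divide_distrib)
    also have "\<dots> = 1" unfolding \<phi>0 using sin_cos_squared_add[of \<phi>0] by (simp add: power2_eq_square add.commute)
    finally have "d t = 1" using \<open>d t = d 0\<close> by simp
    then show ?thesis using speed_pos[of t] by (simp add: d_def)
  qed
  have sc: "sin a * sin a + cos a * cos a = 1" for a :: real
    using sin_cos_squared_add[of a] by (simp only: power2_eq_square)
  have rotate: "a * (s * s + c * c) = (a * c + b * s) * c - (b * c - a * s) * s"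
    "b * (s * s + c * c) = (a * c + b * s) * s + (b * c - a * s) * c" for a b s c :: real
    by (simp_all add: algebra_simps)
  show ?thesis
  proof (rule that[of \<phi>, OF \<phi>])
    fix t
    let ?s = "sin (\<phi> t)" and ?c = "cos (\<phi> t)"
    have "x1 t * (?s * ?s + ?c * ?c) = (x1 t * ?c + y1 t * ?s) * ?c - (y1 t * ?c - x1 t * ?s) * ?s"
      by (rule rotate)
    then show "x1 t = - speed t * ?s" unfolding e d sc by simp
    have "y1 t * (?s * ?s + ?c * ?c) = (x1 t * ?c + y1 t * ?s) * ?s + (y1 t * ?c - x1 t * ?s) * ?c"
      by (rule rotate)
    then show "y1 t = speed t * ?c" unfolding e d sc by simp
  qed
qed

lemma turn_periodic: "turn (t + T) = turn t"
proof -
  have 1: "x1 (s + T) = x1 s" "y1 (s + T) = y1 s" for s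
    by (rule derivative_periodic[of x], rule x, rule periodic, rule derivative_periodic[of y], rule y, rule periodic)
  have 2: "x2 (s + T) = x2 s" "y2 (s + T) = y2 s" for s
    by (rule derivative_periodic[of x1], rule x1, rule 1, rule derivative_periodic[of y1], rule y1, rule 1)
  show ?thesis by (simp add: turn_def 1 2)
qed

text \<open>The normal angle is strictly increasing, and a full period of the curve adds a fixed positive amount to it. Hence it takes all real values and has a
  differentiable inverse.\<close>

lemma parametrization_by_normal_angle:
  obtains \<tau> where "\<And>\<theta>. (\<tau> has_real_derivative 1 / turn (\<tau> \<theta>)) (at \<theta>)"
    "\<And>\<theta>. x1 (\<tau> \<theta>) = - speed (\<tau> \<theta>) * sin \<theta>" "\<And>\<theta>. y1 (\<tau> \<theta>) = speed (\<tau> \<theta>) * cos \<theta>"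
proof -
  obtain \<phi> where \<phi>: "\<And>t. (\<phi> has_real_derivative turn t) (at t)"
    and xy: "\<And>t. x1 t = - speed t * sin (\<phi> t)" "\<And>t. y1 t = speed t * cos (\<phi> t)"
    using tangent_angle by blast
  have mono: "\<phi> s < \<phi> t" if "s < t" for s t
    using DERIV_pos_imp_increasing[OF that, of \<phi>] \<phi> turn_pos by blast
  have cont: "isCont \<phi> t" for t using DERIV_isCont[OF \<phi>] .
  define C where "C = \<phi> T - \<phi> 0"
  have C: "C > 0" using mono[OF T] by (simp add: C_def)
  have "((\<lambda>t. \<phi> (t + T) - \<phi> t) has_real_derivative 0) (at t)" for t
    using DERIV_diff[OF iffD1[OF DERIV_shift \<phi>[of "t + T"]] \<phi>[of t]] by (simp add: turn_periodic)
  then have const: "\<phi> (t + T) - \<phi> t = \<phi> (0 + T) - \<phi> 0" for t using DERIV_isconst_all by blast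
  have shift: "\<phi> (t + T) = \<phi> t + C" for t using const[of t] by (simp add: C_def)
  have shifts: "\<phi> (t + real n * T) = \<phi> t + real n * C" for t n
  proof (induction n)
    case (Suc n)
    then show ?case using shift[of "t + real n * T"] by (simp add: algebra_simps)
  qed simp
  have surj: "\<exists>t. \<phi> t = \<theta>" for \<theta>
  proof -
    obtain n :: nat where n: "\<bar>\<theta> - \<phi> 0\<bar> < real n * C"
      using reals_Archimedean3[OF C] by blast
    have "\<phi> 0 = \<phi> (- (real n * T)) + real n * C" using shifts[of "- (real n * T)" n] by simp
    then have lo: "\<phi> (- (real n * T)) \<le> \<theta>" using n by linarith
    have "\<phi> (real n * T) = \<phi> 0 + real n * C" using shifts[of 0 n] by simp
    then have hi: "\<theta> \<le> \<phi> (real n * T)" using n by linarith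
    have "- (real n * T) \<le> real n * T" using T by simp
    then show ?thesis
      using IVT'[of \<phi> "- (real n * T)" \<theta> "real n * T"] lo hi cont continuous_at_imp_continuous_on by blast
  qed
  define \<tau> where "\<tau> \<theta> = (THE t. \<phi> t = \<theta>)" for \<theta>
  have inj: "s = t" if "\<phi> s = \<phi> t" for s t
    using mono[of s t] mono[of t s] that by (cases s t rule: linorder_cases) auto
  have inv: "\<tau> (\<phi> t) = t" for t unfolding \<tau>_def using inj by blast
  have inv': "\<phi> (\<tau> \<theta>) = \<theta>" for \<theta> using surj[of \<theta>] inv by auto
  have "isCont \<tau> \<theta>" for \<theta>
    using isCont_inverse_function[where d = 1 and x = "\<tau> \<theta>" and g = \<tau> and f = \<phi>] inv cont inv' by simp
  then have "(\<tau> has_real_derivative inverse (turn (\<tau> \<theta>))) (at \<theta>)" for \<theta>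
    using DERIV_inverse_function[where f = \<phi> and g = \<tau> and x = \<theta> and D = "turn (\<tau> \<theta>)"
      and a = "\<theta> - 1" and b = "\<theta> + 1"] \<phi> turn_pos[of "\<tau> \<theta>"] inv'
    by simp
  then show ?thesis using that[of \<tau>] xy[of "\<tau> _"] by (simp add: inv' inverse_eq_divide)
qed

text \<open>At a point where a linear functional is maximal along the curve it annihilates the velocity, hence is a multiple of the
  normal; the second derivative decides the sign, because the acceleration points to the left of the velocity. This is where the
  orientation of the boundary enters.\<close>

lemma maximal_direction:
  assumes "u \<noteq> 0 \<or> v \<noteq> 0" and max: "\<And>s. u * x s + v * y s \<le> u * x t + v * y t"
  obtains k where "k > 0" "u = k * y1 t" "v = - k * x1 t"
proof -
  have f: "((\<lambda>s. u * x s + v * y s) has_real_derivative u * x1 s + v * y1 s) (at s)" for s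
    by (intro DERIV_add DERIV_cmult x y)
  have f1: "((\<lambda>s. u * x1 s + v * y1 s) has_real_derivative u * x2 t + v * y2 t) (at t)"
    by (intro DERIV_add DERIV_cmult x1 y1)
  have d: "u * x1 t + v * y1 t = 0" "u * x2 t + v * y2 t \<le> 0"
    using second_derivative_at_maximum[OF f f1 max] by simp_all
  define k where "k = (u * y1 t - v * x1 t) / ((x1 t)\<^sup>2 + (y1 t)\<^sup>2)"
  have k: "k * ((x1 t)\<^sup>2 + (y1 t)\<^sup>2) = u * y1 t - v * x1 t" using regular[of t] by (simp add: k_def)
  have "(k * y1 t - u) * ((x1 t)\<^sup>2 + (y1 t)\<^sup>2) = - x1 t * (u * x1 t + v * y1 t)"
    "(k * x1 t + v) * ((x1 t)\<^sup>2 + (y1 t)\<^sup>2) = y1 t * (u * x1 t + v * y1 t)"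
    using k by (simp_all add: left_diff_distrib distrib_right mult.assoc mult.left_commute[of k])
      (simp_all add: power2_eq_square algebra_simps)
  then have uv: "u = k * y1 t" "v = - k * x1 t" using d(1) regular[of t] by auto
  have "k * (x1 t * y2 t - y1 t * x2 t) \<ge> 0" using d(2) unfolding uv by (simp add: algebra_simps)
  then have "k \<ge> 0" using curved[of t] by (simp add: zero_le_mult_iff)
  moreover have "k \<noteq> 0" using assms(1) uv by auto
  ultimately show ?thesis using uv by (intro that[of k]) simp_all
qed

text \<open>Since the tangent is orthogonal to the normal, differentiating \<open>h\<close> produces no derivative of the curve, and \<open>h + h''\<close> is the quotient
  of speed and rate of rotation, that is the curvature radius. So \<open>h\<close> has one derivative more than its definition suggests.\<close>

lemma smooth_support:
  assumes \<tau>: "\<And>\<theta>. (\<tau> has_real_derivative 1 / turn (\<tau> \<theta>)) (at \<theta>)"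
    and xy: "\<And>\<theta>. x1 (\<tau> \<theta>) = - speed (\<tau> \<theta>) * sin \<theta>" "\<And>\<theta>. y1 (\<tau> \<theta>) = speed (\<tau> \<theta>) * cos \<theta>"
    and h: "\<And>\<theta>. h \<theta> = x (\<tau> \<theta>) * cos \<theta> + y (\<tau> \<theta>) * sin \<theta>" and per: "\<And>\<theta>. h (\<theta> + 2*pi) = h \<theta>"
  shows "\<exists>h1 h2 h3. smooth_periodic h h1 h2 h3 \<and> (\<forall>\<theta>. h \<theta> + h2 \<theta> > 0)"
proof -
  have h_fun: "h = (\<lambda>\<theta>. x (\<tau> \<theta>) * cos \<theta> + y (\<tau> \<theta>) * sin \<theta>)" using h by blast
  define h1 where "h1 \<theta> = y (\<tau> \<theta>) * cos \<theta> - x (\<tau> \<theta>) * sin \<theta>" for \<theta>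
  define h2 where "h2 \<theta> = speed (\<tau> \<theta>) / turn (\<tau> \<theta>) - h \<theta>" for \<theta>
  define turn1 where "turn1 t = ((x1 t * y3 t - y1 t * x3 t) - turn t * (2 * (x1 t * x2 t + y1 t * y2 t))) / ((x1 t)\<^sup>2 + (y1 t)\<^sup>2)" for t
  define G1 where "G1 t = (stretch t * speed t * turn t - speed t * turn1 t) / (turn t * turn t)" for t
  define h3 where "h3 \<theta> = G1 (\<tau> \<theta>) * (1 / turn (\<tau> \<theta>)) - h1 \<theta>" for \<theta>
  have comp: "((\<lambda>\<theta>. x (\<tau> \<theta>)) has_real_derivative x1 (\<tau> \<theta>) * (1 / turn (\<tau> \<theta>))) (at \<theta>)"
     "((\<lambda>\<theta>. y (\<tau> \<theta>)) has_real_derivative y1 (\<tau> \<theta>) * (1 / turn (\<tau> \<theta>))) (at \<theta>)" for \<theta>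
    by (rule DERIV_chain2[OF x \<tau>], rule DERIV_chain2[OF y \<tau>])
  have turn_ne: "turn t \<noteq> 0" for t using turn_pos[of t] by simp
  have d1: "(h has_real_derivative h1 \<theta>) (at \<theta>)" for \<theta>
    unfolding h_fun h1_def
    by (rule derivative_eq_intros comp refl)+ (simp add: xy algebra_simps)
  have d2: "(h1 has_real_derivative h2 \<theta>) (at \<theta>)" for \<theta>
  proof -
    have "(h1 has_real_derivative (y1 (\<tau> \<theta>) * (1 / turn (\<tau> \<theta>)) * cos \<theta> - y (\<tau> \<theta>) * sin \<theta>)
       - (x1 (\<tau> \<theta>) * (1 / turn (\<tau> \<theta>)) * sin \<theta> + x (\<tau> \<theta>) * cos \<theta>)) (at \<theta>)"
      unfolding h1_def by (auto intro!: derivative_eq_intros comp simp: algebra_simps)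
    also have "(y1 (\<tau> \<theta>) * (1 / turn (\<tau> \<theta>)) * cos \<theta> - y (\<tau> \<theta>) * sin \<theta>)
       - (x1 (\<tau> \<theta>) * (1 / turn (\<tau> \<theta>)) * sin \<theta> + x (\<tau> \<theta>) * cos \<theta>)
       = speed (\<tau> \<theta>) / turn (\<tau> \<theta>) * (sin \<theta> * sin \<theta>)
         + speed (\<tau> \<theta>) / turn (\<tau> \<theta>) * (cos \<theta> * cos \<theta>) - h \<theta>"
      unfolding xy h by (simp add: algebra_simps)
    also have "\<dots> = speed (\<tau> \<theta>) / turn (\<tau> \<theta>) * (sin \<theta> * sin \<theta> + cos \<theta> * cos \<theta>) - h \<theta>"
      by (simp only: distrib_left)
    also have "sin \<theta> * sin \<theta> + cos \<theta> * cos \<theta> = 1" using sin_cos_squared_add[of \<theta>] by (simp only: power2_eq_square)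
    finally show ?thesis by (simp add: h2_def)
  qed
  have "((\<lambda>t. speed t / turn t) has_real_derivative G1 t) (at t)" for t
    unfolding G1_def turn1_def by (intro DERIV_divide speed_deriv turn_deriv turn_ne)
  then have d3: "(h2 has_real_derivative h3 \<theta>) (at \<theta>)" for \<theta>
    unfolding h2_def h3_def by (intro DERIV_diff d1 DERIV_chain2[of "\<lambda>t. speed t / turn t"] \<tau>)
  have reg: "(x1 t)\<^sup>2 + (y1 t)\<^sup>2 \<noteq> 0" for t using regular[of t] by linarith
  have "continuous_on UNIV G1"
    unfolding G1_def stretch_def turn1_def
    by (intro continuous_intros ballI reg) (simp add: turn_ne)
  moreover have "continuous_on UNIV \<tau>"
    using DERIV_isCont[OF \<tau>] by (auto intro: continuous_at_imp_continuous_on)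
  moreover have "continuous_on UNIV h1"
    using DERIV_isCont[OF d2] by (auto intro: continuous_at_imp_continuous_on)
  ultimately have "continuous_on UNIV h3" unfolding h3_def
    using turn_ne by (intro continuous_intros continuous_on_compose2[of UNIV G1 UNIV \<tau>]
      continuous_on_compose2[of UNIV turn UNIV \<tau>]) auto
  then have "smooth_periodic h h1 h2 h3" by (intro smooth_periodic.intro d1 d2 d3 per)
  moreover have "h \<theta> + h2 \<theta> > 0" for \<theta>
    using speed_pos turn_pos by (simp add: h2_def)
  ultimately show ?thesis by blast
qed

end

section \<open>Convex domains and the functional W\<close>

lemma inner_normal_vec: "z \<bullet> normal_vec \<theta> = z $ 1 * cos \<theta> + z $ 2 * sin \<theta>"
  by (simp add: normal_vec_def inner_vec_def sum_2)

lemma inner_vector_2: "vector [a, b] \<bullet> normal_vec \<theta> = a * cos \<theta> + b * sin \<theta>"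
  by (simp add: inner_normal_vec)

lemma unit_direction:
  fixes a :: "real^2"
  obtains \<theta> where "a = norm a *\<^sub>R normal_vec \<theta>"
proof (cases "a = 0")
  case True
  then show ?thesis using that by simp
next
  case False
  have n: "(norm a)\<^sup>2 = (a $ 1)\<^sup>2 + (a $ 2)\<^sup>2"
    unfolding power2_norm_eq_inner by (simp add: inner_vec_def sum_2 power2_eq_square)
  have "(a $ 1 / norm a)\<^sup>2 + (a $ 2 / norm a)\<^sup>2 = ((a $ 1)\<^sup>2 + (a $ 2)\<^sup>2) / (norm a)\<^sup>2"
    by (simp add: power_divide add_divide_distrib)
  also have "\<dots> = 1" unfolding n[symmetric] using False by simp
  finally obtain \<theta> where "a $ 1 / norm a = cos \<theta>" "a $ 2 / norm a = sin \<theta>"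
    using sincos_total_2pi by metis
  then have "a $ 1 = norm a * cos \<theta>" "a $ 2 = norm a * sin \<theta>" using False by (simp_all add: field_simps)
  then have "a = norm a *\<^sub>R normal_vec \<theta>"
    by (simp add: vec_eq_iff forall_2 normal_vec_def)
  then show ?thesis by (rule that)
qed

lemma norm_normal_vec [simp]: "norm (normal_vec \<theta>) = 1"
  by (simp add: norm_eq_sqrt_inner inner_normal_vec) (simp add: normal_vec_def flip: power2_eq_square)

lemma normal_vec_add_pi: "normal_vec (\<theta> + pi) = - normal_vec \<theta>"
  by (simp add: normal_vec_def vec_eq_iff forall_2)

lemma inner_le_support:
  assumes "compact K" "x \<in> K"
  shows "x \<bullet> normal_vec \<theta> \<le> support_fun K \<theta>"
  unfolding support_fun_def
proof (rule cSUP_upper[OF assms(2)])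
  have "compact ((\<lambda>x. x \<bullet> normal_vec \<theta>) ` K)"
    by (intro compact_continuous_image continuous_intros assms)
  then show "bdd_above ((\<lambda>x. x \<bullet> normal_vec \<theta>) ` K)" by (simp add: bounded_imp_bdd_above compact_imp_bounded)
qed

lemma support_le:
  assumes "K \<noteq> {}" "\<And>x. x \<in> K \<Longrightarrow> x \<bullet> normal_vec \<theta> \<le> b"
  shows "support_fun K \<theta> \<le> b"
  unfolding support_fun_def using assms by (intro cSUP_least)

text \<open>A point outside is separated from the domain by a line, whose normal direction violates the inequality.\<close>

lemma mem_iff_support:
  assumes "compact K" "convex K" "K \<noteq> {}"
  shows "z \<in> K \<longleftrightarrow> (\<forall>\<theta>. z \<bullet> normal_vec \<theta> \<le> support_fun K \<theta>)"
proof
  assume le: "\<forall>\<theta>. z \<bullet> normal_vec \<theta> \<le> support_fun K \<theta>"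
  show "z \<in> K"
  proof (rule ccontr)
    assume "z \<notin> K"
    then obtain a b where ab: "a \<bullet> z < b" "\<And>x. x \<in> K \<Longrightarrow> a \<bullet> x > b"
      using separating_hyperplane_closed_point[of K z] assms compact_imp_closed by blast
    have a: "a \<noteq> 0" using ab assms(3) by force
    obtain \<theta> where \<theta>: "- a = norm (- a) *\<^sub>R normal_vec \<theta>" by (rule unit_direction)
    have scale: "norm a * (x \<bullet> normal_vec \<theta>) = - (a \<bullet> x)" for x
      using arg_cong[OF \<theta>, of "\<lambda>v. v \<bullet> x"] by (simp add: inner_commute)
    have "support_fun K \<theta> \<le> - b / norm a"
    proof (rule support_le[OF assms(3)])
      fix x assume "x \<in> K"
      then have "norm a * (x \<bullet> normal_vec \<theta>) \<le> - b" using ab(2)[of x] scale[of x] by simp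
      then show "x \<bullet> normal_vec \<theta> \<le> - b / norm a" using a by (subst pos_le_divide_eq) (simp_all add: mult.commute)
    qed
    also have "\<dots> < z \<bullet> normal_vec \<theta>"
      using a ab(1) scale[of z] by (subst pos_divide_less_eq) (simp_all add: mult.commute)
    finally show False using le by (simp add: not_less[symmetric])
  qed
qed (use inner_le_support assms in blast)

lemma subset_cball_iff_support:
  assumes "compact K" "K \<noteq> {}" "s \<ge> 0"
  shows "K \<subseteq> cball x s \<longleftrightarrow> (\<forall>\<theta>. support_fun K \<theta> \<le> s + x \<bullet> normal_vec \<theta>)"
proof
  assume K: "K \<subseteq> cball x s"
  show "\<forall>\<theta>. support_fun K \<theta> \<le> s + x \<bullet> normal_vec \<theta>"
  proof (intro allI support_le[OF assms(2)])
    fix \<theta> y assume "y \<in> K"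
    then have "norm (y - x) \<le> s" using K by (auto simp: dist_norm norm_minus_commute)
    moreover have "(y - x) \<bullet> normal_vec \<theta> \<le> norm (y - x)"
      using norm_cauchy_schwarz[of "y - x" "normal_vec \<theta>"] by simp
    ultimately show "y \<bullet> normal_vec \<theta> \<le> s + x \<bullet> normal_vec \<theta>" by (simp add: inner_diff_left)
  qed
next
  assume le: "\<forall>\<theta>. support_fun K \<theta> \<le> s + x \<bullet> normal_vec \<theta>"
  show "K \<subseteq> cball x s"
  proof
    fix y assume y: "y \<in> K"
    obtain \<theta> where \<theta>: "y - x = norm (y - x) *\<^sub>R normal_vec \<theta>" by (rule unit_direction)
    have "normal_vec \<theta> \<bullet> normal_vec \<theta> = 1" by (simp add: norm_eq_1[symmetric])
    then have "(y - x) \<bullet> normal_vec \<theta> = norm (y - x)" using arg_cong[OF \<theta>, of "\<lambda>v. v \<bullet> normal_vec \<theta>"] by simp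
    moreover have "y \<bullet> normal_vec \<theta> \<le> s + x \<bullet> normal_vec \<theta>"
      using inner_le_support[OF assms(1) y, of \<theta>] le by (meson order_trans)
    ultimately show "y \<in> cball x s" by (simp add: inner_diff_left dist_norm norm_minus_commute)
  qed
qed

lemma cball_subset_iff_support:
  assumes "compact K" "convex K" "K \<noteq> {}" "s \<ge> 0"
  shows "cball x s \<subseteq> K \<longleftrightarrow> (\<forall>\<theta>. s + x \<bullet> normal_vec \<theta> \<le> support_fun K \<theta>)"
proof
  assume K: "cball x s \<subseteq> K"
  show "\<forall>\<theta>. s + x \<bullet> normal_vec \<theta> \<le> support_fun K \<theta>"
  proof
    fix \<theta>
    have "x + s *\<^sub>R normal_vec \<theta> \<in> K" using K assms(4) by (auto simp: dist_norm)
    from inner_le_support[OF assms(1) this, of \<theta>]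
    show "s + x \<bullet> normal_vec \<theta> \<le> support_fun K \<theta>"
      by (simp add: inner_add_left norm_eq_1[THEN iffD1] add.commute)
  qed
next
  assume le: "\<forall>\<theta>. s + x \<bullet> normal_vec \<theta> \<le> support_fun K \<theta>"
  show "cball x s \<subseteq> K"
  proof
    fix y assume "y \<in> cball x s"
    then have "norm (y - x) \<le> s" by (simp add: dist_norm norm_minus_commute)
    then have y: "(y - x) \<bullet> normal_vec \<theta> \<le> s" for \<theta>
      using norm_cauchy_schwarz[of "y - x" "normal_vec \<theta>"] by simp
    have "y \<bullet> normal_vec \<theta> \<le> support_fun K \<theta>" for \<theta>
      using le[rule_format, of \<theta>] y[of \<theta>] unfolding inner_diff_left by linarith
    then show "y \<in> K" using mem_iff_support[OF assms(1-3)] by blast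
  qed
qed

text \<open>At each boundary point there is a supporting line. Its outward normal is a positive multiple of \<open>(y', - x')\<close>,
  so the boundary point with normal angle \<open>\<theta>\<close> attains the maximum in direction \<open>\<theta>\<close>.\<close>

lemma domain_support_smooth:
  assumes "smooth_strictly_convex_domain K"
  shows "\<exists>p1 p2 p3. smooth_periodic (support_fun K) p1 p2 p3 \<and> (\<forall>\<theta>. support_fun K \<theta> + p2 \<theta> > 0)"
proof -
  from assms obtain c where K: "compact K" "interior K \<noteq> {}" "convex K" and c: "pos_curved_boundary K c"
    by (auto simp: smooth_strictly_convex_domain_def strictly_convex_def)
  from c obtain D where D0: "D 0 = c" and D: "\<And>n t. (D n has_vector_derivative D (Suc n) t) (at t)"
    by (auto simp: pos_curved_boundary_def smooth_map_def)
  from c obtain T where T: "T > 0" "\<And>t. c (t + T) = c t" by (auto simp: pos_curved_boundary_def)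
  from c have fr: "frontier K = range c" and curv: "\<And>t. signed_curvature c t > 0"
    by (auto simp: pos_curved_boundary_def)
  have comp: "((\<lambda>t. D n t $ i) has_real_derivative D (Suc n) t $ i) (at t)" for n i t
    using bounded_linear.has_vector_derivative[OF bounded_linear_vec_nth D]
    by (simp add: has_real_derivative_iff_has_vector_derivative)
  have cont: "continuous_on UNIV (\<lambda>t. D n t $ i)" for n i
    using DERIV_isCont[OF comp] by (auto intro: continuous_at_imp_continuous_on)
  have vel: "vector_derivative (D n) (at t) = D (Suc n) t" for n t
    using D by (rule vector_derivative_at)
  have num: "D 1 t $ 1 * D 2 t $ 2 - D 1 t $ 2 * D 2 t $ 1 > 0" for t
  proof -
    have v1: "velocity c t = D 1 t" for t using vel[of 0 t] D0 by simp
    have v2: "velocity (D 1) t = D 2 t" using vel[of 1 t] by (simp add: numeral_2_eq_2)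
    show ?thesis using curv[of t, unfolded signed_curvature_def v1 v2]
      by (simp add: zero_less_divide_iff)
  qed
  interpret positively_curved "\<lambda>t. c t $ 1" "\<lambda>t. D 1 t $ 1" "\<lambda>t. D 2 t $ 1" "\<lambda>t. D 3 t $ 1"
    "\<lambda>t. c t $ 2" "\<lambda>t. D 1 t $ 2" "\<lambda>t. D 2 t $ 2" "\<lambda>t. D 3 t $ 2" T
    using comp[of 0] comp[of 1] comp[of 2] cont num T
    by unfold_locales (simp_all add: D0 numeral_2_eq_2 numeral_3_eq_3)
  obtain \<tau> where \<tau>: "\<And>\<theta>. (\<tau> has_real_derivative 1 / turn (\<tau> \<theta>)) (at \<theta>)"
    "\<And>\<theta>. D 1 (\<tau> \<theta>) $ 1 = - speed (\<tau> \<theta>) * sin \<theta>" "\<And>\<theta>. D 1 (\<tau> \<theta>) $ 2 = speed (\<tau> \<theta>) * cos \<theta>"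
    using parametrization_by_normal_angle by blast
  have cK: "c t \<in> K" "c t \<notin> interior K" for t
  proof -
    have "c t \<in> frontier K" using fr by simp
    then show "c t \<in> K" "c t \<notin> interior K" using closure_closed[OF compact_imp_closed[OF K(1)]] by (simp_all add: frontier_def)
  qed
  have support: "support_fun K \<theta> = c (\<tau> \<theta>) \<bullet> normal_vec \<theta>" for \<theta>
  proof (rule antisym)
    let ?t = "\<tau> \<theta>"
    obtain a where a: "a \<noteq> 0" "\<And>y. y \<in> K \<Longrightarrow> a \<bullet> c ?t \<le> a \<bullet> y"
      using supporting_hyperplane_rel_boundary[OF K(3) cK(1)[of ?t]] cK(2)[of ?t]
        rel_interior_nonempty_interior[OF K(2)] by metis
    have "- a $ 1 \<noteq> 0 \<or> - a $ 2 \<noteq> 0" using a(1) by (auto simp: vec_eq_iff forall_2)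
    moreover have "- a $ 1 * c s $ 1 + - a $ 2 * c s $ 2 \<le> - a $ 1 * c ?t $ 1 + - a $ 2 * c ?t $ 2" for s
      using a(2)[OF cK(1)[of s]] by (simp add: inner_vec_def sum_2)
    ultimately obtain k where k: "k > 0" "- a $ 1 = k * D 1 ?t $ 2" "- a $ 2 = - k * D 1 ?t $ 1"
      by (rule maximal_direction)
    have pos: "k * speed ?t > 0" using k(1) speed_pos by simp
    have a_inner: "k * speed ?t * (y \<bullet> normal_vec \<theta>) = - (a \<bullet> y)" for y
    proof -
      define m where "m = k * speed ?t"
      have "a $ 1 = - (m * cos \<theta>)" "a $ 2 = - (m * sin \<theta>)"
        using k(2,3) unfolding \<tau>(2,3) m_def by simp_all
      then show ?thesis
        unfolding m_def[symmetric] inner_normal_vec by (simp add: inner_vec_def sum_2 algebra_simps)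
    qed
    show "support_fun K \<theta> \<le> c ?t \<bullet> normal_vec \<theta>"
    proof (rule support_le)
      show "K \<noteq> {}" using K(2) by auto
      fix y assume "y \<in> K"
      then have "k * speed ?t * (y \<bullet> normal_vec \<theta>) \<le> k * speed ?t * (c ?t \<bullet> normal_vec \<theta>)"
        using a(2) unfolding a_inner by simp
      then show "y \<bullet> normal_vec \<theta> \<le> c ?t \<bullet> normal_vec \<theta>" using pos by (rule mult_left_le_imp_le)
    qed
    show "c ?t \<bullet> normal_vec \<theta> \<le> support_fun K \<theta>" by (rule inner_le_support[OF K(1) cK(1)])
  qed
  have h: "support_fun K \<theta> = c (\<tau> \<theta>) $ 1 * cos \<theta> + c (\<tau> \<theta>) $ 2 * sin \<theta>" for \<theta>
    by (simp only: support inner_normal_vec)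
  have "support_fun K (\<theta> + 2*pi) = support_fun K \<theta>" for \<theta>
    by (simp add: support_fun_def normal_vec_def)
  then show ?thesis by (rule smooth_support[OF \<tau> h])
qed

locale convex_domain =
  fixes K :: "(real^2) set" and p1 p2 p3 :: "real \<Rightarrow> real"
  assumes compact: "compact K" and convex: "convex K" and interior: "interior K \<noteq> {}"
    and smooth: "smooth_periodic (support_fun K) p1 p2 p3"
    and radius_pos: "\<And>\<theta>. support_fun K \<theta> + p2 \<theta> > 0"

sublocale convex_domain \<subseteq> smooth_periodic "support_fun K" p1 p2 p3
  by (rule smooth)

context convex_domain
begin

lemma nonempty: "K \<noteq> {}" using interior by auto

lemma deriv_support: "deriv (support_fun K) = p1" "deriv p1 = p2" "deriv p2 = p3"
  by (rule ext, rule DERIV_imp_deriv, rule p p1 p2)+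

lemma curv_radius_eq: "curv_radius K \<theta> = support_fun K \<theta> + p2 \<theta>"
  by (simp add: curv_radius_def deriv_support numeral_2_eq_2)

lemma evolute_curv_radius_eq: "evolute_curv_radius K \<theta> = \<bar>p1 \<theta> + p3 \<theta>\<bar>"
  by (simp add: evolute_curv_radius_def deriv_support numeral_3_eq_3)

lemma bdry_length_eq: "bdry_length K = perimeter"
  by (simp add: bdry_length_def curv_radius_eq[abs_def] perimeter_def)

lemma area_eq: "area K = encl_area"
  by (simp add: area_def deriv_support encl_area_def)

lemma evolute_area_eq: "evolute_area K = signed_evolute_area"
proof -
  have e: "evolute K \<theta> $ 1 = - p1 \<theta> * sin \<theta> - p2 \<theta> * cos \<theta>"
    "evolute K \<theta> $ 2 = p1 \<theta> * cos \<theta> - p2 \<theta> * sin \<theta>" for \<theta>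
    by (simp_all add: evolute_def bdry_curve_def normal_vec_def curv_radius_eq deriv_support algebra_simps)
  have "((\<lambda>t. evolute K t $ 1) has_real_derivative - (p1 \<theta> + p3 \<theta>) * cos \<theta>) (at \<theta>)"
    "((\<lambda>t. evolute K t $ 2) has_real_derivative - (p1 \<theta> + p3 \<theta>) * sin \<theta>) (at \<theta>)" for \<theta>
    unfolding e by (auto intro!: derivative_eq_intros p1 p2 simp: algebra_simps)
  then have d: "deriv (\<lambda>t. evolute K t $ 1) \<theta> = - (p1 \<theta> + p3 \<theta>) * cos \<theta>"
    "deriv (\<lambda>t. evolute K t $ 2) \<theta> = - (p1 \<theta> + p3 \<theta>) * sin \<theta>" for \<theta>
    by (auto intro: DERIV_imp_deriv)
  have "evolute K \<theta> $ 1 * deriv (\<lambda>t. evolute K t $ 2) \<theta>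
      - evolute K \<theta> $ 2 * deriv (\<lambda>t. evolute K t $ 1) \<theta> = p1 \<theta> * (p1 \<theta> + p3 \<theta>)" for \<theta>
  proof -
    have "evolute K \<theta> $ 1 * deriv (\<lambda>t. evolute K t $ 2) \<theta> - evolute K \<theta> $ 2 * deriv (\<lambda>t. evolute K t $ 1) \<theta>
      = p1 \<theta> * (p1 \<theta> + p3 \<theta>) * ((sin \<theta>)\<^sup>2 + (cos \<theta>)\<^sup>2)"
      unfolding d unfolding e power2_eq_square by (simp add: algebra_simps del: sin_cos_squared_add3)
    then show ?thesis by simp
  qed
  then show ?thesis by (simp add: evolute_area_def signed_evolute_area_eq_evolute)
qed

lemma circumscribable_iff: "circumscribable s \<longleftrightarrow> s \<ge> 0 \<and> (\<exists>x. K \<subseteq> cball x s)"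
proof
  assume "circumscribable s"
  then obtain a b where "\<And>\<theta>. support_fun K \<theta> \<le> s + (a * cos \<theta> + b * sin \<theta>)" by (auto simp: circumscribable_def)
  then have le: "support_fun K \<theta> \<le> s + vector [a, b] \<bullet> normal_vec \<theta>" for \<theta> by (simp add: inner_vector_2)
  obtain z where "z \<in> K" using nonempty by blast
  then have "z \<bullet> normal_vec \<theta> \<le> s + vector [a, b] \<bullet> normal_vec \<theta>" for \<theta>
    using inner_le_support[OF compact] le by (meson order_trans)
  from this[of 0] this[of "0 + pi"] have "s \<ge> 0"
    unfolding normal_vec_add_pi inner_minus_right by linarith
  moreover from this have "K \<subseteq> cball (vector [a, b]) s"
    using subset_cball_iff_support[OF compact nonempty, of s "vector [a, b]"] le by simp
  ultimately show "s \<ge> 0 \<and> (\<exists>x. K \<subseteq> cball x s)" by blast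
next
  assume "s \<ge> 0 \<and> (\<exists>x. K \<subseteq> cball x s)"
  then obtain x where "s \<ge> 0" "K \<subseteq> cball x s" by blast
  then have "\<forall>\<theta>. support_fun K \<theta> \<le> s + (x $ 1 * cos \<theta> + x $ 2 * sin \<theta>)"
    using subset_cball_iff_support[OF compact nonempty, of s x] by (simp add: inner_normal_vec)
  then show "circumscribable s" unfolding circumscribable_def
    by - (rule exI[where x = "x $ 1"], rule exI[where x = "x $ 2"], assumption)
qed

lemma inscribable_iff:
  assumes "s \<ge> 0"
  shows "inscribable s \<longleftrightarrow> (\<exists>x. cball x s \<subseteq> K)"
proof
  assume "inscribable s"
  then obtain a b where "\<And>\<theta>. s + (a * cos \<theta> + b * sin \<theta>) \<le> support_fun K \<theta>" by (auto simp: inscribable_def)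
  then have "s + vector [a, b] \<bullet> normal_vec \<theta> \<le> support_fun K \<theta>" for \<theta> by (simp add: inner_vector_2)
  then have "cball (vector [a, b]) s \<subseteq> K"
    using cball_subset_iff_support[OF compact convex nonempty assms, of "vector [a, b]"] by simp
  then show "\<exists>x. cball x s \<subseteq> K" by blast
next
  assume "\<exists>x. cball x s \<subseteq> K"
  then obtain x where "cball x s \<subseteq> K" by blast
  then have "\<forall>\<theta>. s + (x $ 1 * cos \<theta> + x $ 2 * sin \<theta>) \<le> support_fun K \<theta>"
    using cball_subset_iff_support[OF compact convex nonempty assms, of x] by (simp add: inner_normal_vec)
  then show "inscribable s" unfolding inscribable_def
    by - (rule exI[where x = "x $ 1"], rule exI[where x = "x $ 2"], assumption)
qed

lemma circumradius_least: "circumscribable (circumradius K)" "\<And>s. circumscribable s \<Longrightarrow> circumradius K \<le> s"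
proof -
  obtain R where R: "circumscribable R" "\<And>s. circumscribable s \<Longrightarrow> R \<le> s" using least_circumscribable by blast
  have "circumradius K = R"
    unfolding circumradius_def circumscribable_iff[symmetric]
  proof (rule cInf_eq_minimum)
    show "R \<in> {r. circumscribable r}" using R(1) by simp
    show "R \<le> s" if "s \<in> {r. circumscribable r}" for s using R(2)[of s] that by simp
  qed
  with R show "circumscribable (circumradius K)" "\<And>s. circumscribable s \<Longrightarrow> circumradius K \<le> s" by simp_all
qed

lemma inradius_root: "encl_area - perimeter * inradius K + pi * (inradius K)\<^sup>2 \<le> 0"
proof -
  obtain r where r: "inscribable r" "\<And>s. inscribable s \<Longrightarrow> s \<le> r" "encl_area - perimeter * r + pi * r\<^sup>2 \<le> 0"
    using greatest_inscribable by blast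
  obtain z where "z \<in> K" using nonempty by blast
  then have "cball z 0 \<subseteq> K" by simp
  then have "inscribable 0" using inscribable_iff[of 0] by blast
  then have "r \<ge> 0" using r(2) by blast
  have "inradius K = r"
    unfolding inradius_def
  proof (rule cSup_eq_maximum)
    show "r \<in> {r. r \<ge> 0 \<and> (\<exists>x. cball x r \<subseteq> K)}"
      using r(1) inscribable_iff[OF \<open>r \<ge> 0\<close>] \<open>r \<ge> 0\<close> by simp
    show "s \<le> r" if "s \<in> {r. r \<ge> 0 \<and> (\<exists>x. cball x r \<subseteq> K)}" for s
      using r(2)[of s] inscribable_iff[of s] that by simp
  qed
  then show ?thesis using r(3) by simp
qed

lemma bonnesen_domain:
  "(circumradius K - inradius K)\<^sup>2 \<le> 2 * deficit / pi"
  "(circumradius K - inradius K)\<^sup>2 = 2 * deficit / pi \<Longrightarrow>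
     \<exists>a b. \<forall>x. support_fun K x = circumradius K + (a * cos x + b * sin x)"
proof -
  have le: "pi\<^sup>2 * (circumradius K - inradius K)\<^sup>2 \<le> 2 * pi * deficit"
    by (rule bonnesen(1)[OF circumradius_least(1) _ inradius_root]) (rule circumradius_least(2))
  have eq: "pi\<^sup>2 * (2 * deficit / pi) = 2 * pi * deficit" by (simp add: power2_eq_square)
  show "(circumradius K - inradius K)\<^sup>2 \<le> 2 * deficit / pi"
    using le unfolding eq[symmetric] by (rule mult_left_le_imp_le) (rule zero_less_power[OF pi_gt_zero])
  show "\<exists>a b. \<forall>x. support_fun K x = circumradius K + (a * cos x + b * sin x)"
    if "(circumradius K - inradius K)\<^sup>2 = 2 * deficit / pi"
  proof (rule bonnesen(2)[OF circumradius_least(1) _ inradius_root])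
    show "circumradius K \<le> s" if "circumscribable s" for s using that by (rule circumradius_least(2))
    show "pi\<^sup>2 * (circumradius K - inradius K)\<^sup>2 = 2 * pi * deficit" unfolding that by (rule eq)
  qed
qed

text \<open>The curvature radius differs from the midpoint of its range by at most half the length of the range.\<close>

lemma radius_range: "6 * deficit / pi \<le> (max_curv_radius K - min_curv_radius K)\<^sup>2"
proof -
  have "compact (curv_radius K ` {0..2*pi})"
    unfolding curv_radius_eq[abs_def] by (intro compact_continuous_image continuous_intros compact_Icc)
  then have bdd: "bdd_above (curv_radius K ` {0..2*pi})" "bdd_below (curv_radius K ` {0..2*pi})"
    by (auto simp: bounded_imp_bdd_above bounded_imp_bdd_below compact_imp_bounded)
  define c d where "c = (max_curv_radius K + min_curv_radius K) / 2"
    and "d = (max_curv_radius K - min_curv_radius K) / 2"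
  have "\<bar>support_fun K x + p2 x - c\<bar> \<le> d" if "x \<in> {0..2*pi}" for x
  proof -
    have "curv_radius K x \<le> max_curv_radius K" "min_curv_radius K \<le> curv_radius K x"
      unfolding max_curv_radius_def min_curv_radius_def
      by (rule cSUP_upper[OF that bdd(1)], rule cINF_lower[OF bdd(2) that])
    then have "support_fun K x + p2 x - c \<le> d" "- (support_fun K x + p2 x - c) \<le> d"
      by (simp_all add: curv_radius_eq c_def d_def field_simps)
    then show ?thesis by (rule abs_leI)
  qed
  then have "radius_variance \<le> 2 * pi * d\<^sup>2" by (rule radius_variance_le)
  then have "3 * deficit \<le> 2 * pi * d\<^sup>2" using three_deficit_le by simp
  then show ?thesis by (simp add: d_def power_divide pos_divide_le_eq mult.commute)
qed

lemma disk_of_support: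
  assumes "\<And>\<theta>. support_fun K \<theta> = s + (a * cos \<theta> + b * sin \<theta>)"
  shows "is_disk K"
proof -
  have "circumscribable s" using assms unfolding circumscribable_def by force
  then have s: "s \<ge> 0" by (simp add: circumscribable_iff)
  have K: "K = cball (vector [a, b]) s"
    using subset_cball_iff_support[OF compact nonempty s, of "vector [a, b]"]
      cball_subset_iff_support[OF compact convex nonempty s, of "vector [a, b]"]
    by (simp add: assms inner_vector_2)
  have "s \<noteq> 0"
  proof
    assume "s = 0"
    then have "K = {vector [a, b]}" using K by simp
    then show False using interior by simp
  qed
  with s have "s > 0" by simp
  with K show ?thesis unfolding is_disk_def by (intro exI conjI)
qed

lemma support_of_disk:
  assumes "is_disk K"
  obtains s a b where "\<And>\<theta>. support_fun K \<theta> = s + (a * cos \<theta> + b * sin \<theta>)"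
proof -
  from assms obtain x r where r: "r > 0" "K = cball x r" by (auto simp: is_disk_def)
  then have "support_fun K \<theta> = r + x \<bullet> normal_vec \<theta>" for \<theta>
    using subset_cball_iff_support[OF compact nonempty, of r x]
      cball_subset_iff_support[OF compact convex nonempty, of r x] by (intro antisym) auto
  then show ?thesis using that[of r "x $ 1" "x $ 2"] by (simp add: inner_normal_vec)
qed

lemma perimeter_pos: "perimeter > 0"
proof (rule ccontr)
  assume "\<not> perimeter > 0"
  then have "support_fun K 0 + p2 0 = 0"
    using circ_pos_zero[of "\<lambda>x. support_fun K x + p2 x" 0] radius_pos
    by (auto simp: perimeter_def intro!: continuous_intros less_imp_le)
  then show False using radius_pos[of 0] by simp
qed

definition curvature_energy where "curvature_energy = circ (\<lambda>\<theta>. (curvature K \<theta>)\<^sup>2 * curv_radius K \<theta>)"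

lemma curvature_energy_nonneg: "curvature_energy \<ge> 0"
  unfolding curvature_energy_def by (rule circ_nonneg) (simp add: curv_radius_eq radius_pos less_imp_le)

lemma abs_signed_evolute_area: "\<bar>signed_evolute_area\<bar> = (radius_variance + deficit) / 2"
proof -
  have "signed_evolute_area \<le> 0" using signed_evolute_area_eq deficit_nonneg three_deficit_le by linarith
  then have "\<bar>signed_evolute_area\<bar> = - signed_evolute_area" by (rule abs_of_nonpos)
  then show ?thesis using signed_evolute_area_eq by (simp add: field_simps)
qed

text \<open>The \<open>\<zeta>\<close>-term is increased by \<open>2 \<zeta> \<integral>\<rho>\<^sup>2\<close>, and the term with \<open>\<alpha>\<close> is decreased accordingly, so that the coefficients are those that
  occur in the conditions on the parameters.\<close>

lemma W_eq:
  "W K \<alpha> \<delta> \<mu> \<sigma> \<eta> lam \<xi> \<zeta> =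
     (2*\<alpha> + 4*pi*\<delta> + \<mu> - 4*\<zeta>) * (perimeter\<^sup>2 / (4*pi))
     + (\<alpha> - 2*\<zeta> + \<sigma>/2) * radius_variance + (\<sigma> - \<mu>)/2 * deficit
     + \<eta> * circ (\<lambda>\<theta>. (p1 \<theta> + p3 \<theta>)\<^sup>2)
     + lam * (circumradius K - inradius K)\<^sup>2
     + \<xi> * (max_curv_radius K - min_curv_radius K)\<^sup>2
     + \<zeta> * (curvature_energy + 2 * radius_variance + perimeter\<^sup>2 / pi)"
proof -
  define q where "q = perimeter\<^sup>2 / (4*pi)"
  have encl_area: "encl_area = q - deficit / 2" by (simp add: q_def deficit_def field_simps)
  have rho: "circ (\<lambda>\<theta>. (curv_radius K \<theta>)\<^sup>2) = 2 * q + radius_variance"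
    by (simp add: q_def curv_radius_eq square_radius_integral)
  have perimeter: "perimeter\<^sup>2 / pi = 4 * q" "perimeter\<^sup>2 = 4 * pi * q" by (simp_all add: q_def)
  show ?thesis
    unfolding W_def curvature_energy_def[symmetric] bdry_length_eq area_eq evolute_area_eq abs_signed_evolute_area evolute_curv_radius_eq power2_abs
      q_def[symmetric] encl_area rho perimeter
    by (simp add: field_simps)
qed

text \<open>Estimate \<open>\<integral>\<rho>'\<^sup>2\<close> by \<open>4 V\<close> and then \<open>V\<close> by \<open>3 E\<close>. The coefficient of \<open>V\<close> in the second step is \<open>c2 / 2 + 5 \<eta> \<ge> 0\<close>. The resulting coefficient
  \<open>b\<close> of \<open>E\<close> is bounded below by the last condition, and this bound is distributed over the two gap terms.\<close>

lemma W_lower_bound: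
  assumes "admissible \<alpha> \<delta> \<mu> \<sigma> \<eta> lam \<xi> \<zeta>"
  shows "W K \<alpha> \<delta> \<mu> \<sigma> \<eta> lam \<xi> \<zeta> \<ge>
     \<xi> * ((max_curv_radius K - min_curv_radius K)\<^sup>2 - 2 * deficit / pi)
     + (- lam) * (2 * deficit / pi - (circumradius K - inradius K)\<^sup>2)
     + \<zeta> * (curvature_energy + 2 * radius_variance + perimeter\<^sup>2 / pi)"
proof -
  define c1 where "c1 = 2*\<alpha> + 4*pi*\<delta> + \<mu> - 4*\<zeta>"
  define c2 where "c2 = 2*\<alpha> + \<sigma> - 2*\<eta> - 4*\<zeta>"
  define b where "b = 3*\<alpha> - 6*\<zeta> + 2*\<sigma> + 12*\<eta> - \<mu>/2"
  have c: "c1 \<ge> 0" "c2 \<ge> 0" "\<eta> \<ge> 0" and c3: "2 * pi * b + 4 * lam + 4 * \<xi> \<ge> 0"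
    using assms by (auto simp: admissible_def c1_def c2_def b_def algebra_simps)
  have "c1 * (perimeter\<^sup>2 / (4*pi)) \<ge> 0" using c by simp
  moreover have "\<eta> * circ (\<lambda>\<theta>. (p1 \<theta> + p3 \<theta>)\<^sup>2) \<ge> \<eta> * (4 * radius_variance)"
    using four_radius_variance_le c by (intro mult_left_mono)
  moreover have "(c2/2 + 5*\<eta>) * radius_variance \<ge> (c2/2 + 5*\<eta>) * (3 * deficit)"
    using three_deficit_le c by (intro mult_left_mono) auto
  moreover have "(\<alpha> - 2*\<zeta> + \<sigma>/2) * radius_variance + \<eta> * (4 * radius_variance) = (c2/2 + 5*\<eta>) * radius_variance"
    by (simp add: c2_def field_simps)
  moreover have "b * deficit = (c2/2 + 5*\<eta>) * (3 * deficit) + (\<sigma> - \<mu>)/2 * deficit"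
    by (simp add: c2_def b_def field_simps)
  moreover have "b * deficit \<ge> - (lam + \<xi>) * (2 * deficit / pi)"
  proof -
    have "(2 * pi * b + 4 * lam + 4 * \<xi>) * (deficit / (2 * pi)) \<ge> 0"
      using c3 deficit_nonneg by simp
    then show ?thesis by (simp add: field_simps)
  qed
  moreover have "- (lam + \<xi>) * (2 * deficit / pi) = - lam * (2 * deficit / pi) - \<xi> * (2 * deficit / pi)"
    by (simp only: minus_add_distrib left_diff_distrib' distrib_right diff_conv_add_uminus mult_minus_left)
  ultimately show ?thesis unfolding W_eq c1_def[symmetric] right_diff_distrib by linarith
qed

text \<open>The excess \<open>4 E / \<pi>\<close> in the first inequality is what yields the disk in the case of equality with \<open>\<xi> \<noteq> 0\<close>.\<close>

lemma gaps_nonneg: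
  "(max_curv_radius K - min_curv_radius K)\<^sup>2 - 2 * deficit / pi \<ge> 4 * deficit / pi"
  "2 * deficit / pi - (circumradius K - inradius K)\<^sup>2 \<ge> 0"
  "curvature_energy + 2 * radius_variance + perimeter\<^sup>2 / pi > 0"
proof -
  show "(max_curv_radius K - min_curv_radius K)\<^sup>2 - 2 * deficit / pi \<ge> 4 * deficit / pi"
    using radius_range by (simp add: field_simps)
  show "2 * deficit / pi - (circumradius K - inradius K)\<^sup>2 \<ge> 0" using bonnesen_domain(1) by simp
  have "perimeter\<^sup>2 / pi > 0" using perimeter_pos by simp
  then show "curvature_energy + 2 * radius_variance + perimeter\<^sup>2 / pi > 0"
    using curvature_energy_nonneg three_deficit_le deficit_nonneg by linarith
qed

lemma weighted_gaps_nonneg: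
  assumes "admissible \<alpha> \<delta> \<mu> \<sigma> \<eta> lam \<xi> \<zeta>"
  shows "0 \<le> \<xi> * ((max_curv_radius K - min_curv_radius K)\<^sup>2 - 2 * deficit / pi)"
    "0 \<le> (- lam) * (2 * deficit / pi - (circumradius K - inradius K)\<^sup>2)"
    "0 \<le> \<zeta> * (curvature_energy + 2 * radius_variance + perimeter\<^sup>2 / pi)"
proof -
  have signs: "\<xi> \<ge> 0" "- lam \<ge> 0" "\<zeta> \<ge> 0" using assms by (auto simp: admissible_def)
  have "0 \<le> 4 * deficit / pi" using deficit_nonneg by simp
  then have "0 \<le> (max_curv_radius K - min_curv_radius K)\<^sup>2 - 2 * deficit / pi" using gaps_nonneg(1) by linarith
  with signs(1) show "0 \<le> \<xi> * ((max_curv_radius K - min_curv_radius K)\<^sup>2 - 2 * deficit / pi)"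
    by (rule mult_nonneg_nonneg)
  show "0 \<le> (- lam) * (2 * deficit / pi - (circumradius K - inradius K)\<^sup>2)"
    using signs(2) gaps_nonneg(2) by (rule mult_nonneg_nonneg)
  show "0 \<le> \<zeta> * (curvature_energy + 2 * radius_variance + perimeter\<^sup>2 / pi)"
    using signs(3) less_imp_le[OF gaps_nonneg(3)] by (rule mult_nonneg_nonneg)
qed

text \<open>For a disk \<open>V\<close> and \<open>E\<close> vanish, and Bonnesen's inequality then gives that circumradius and inradius agree.\<close>

lemma W_disk:
  assumes "is_disk K" "2*\<alpha> + 4*pi*\<delta> + \<mu> = 0"
  shows "W K \<alpha> \<delta> \<mu> \<sigma> \<eta> lam \<xi> 0 = 0"
proof -
  obtain s a b where s: "\<And>\<theta>. support_fun K \<theta> = s + (a * cos \<theta> + b * sin \<theta>)"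
    using support_of_disk[OF assms(1)] by blast
  have rho: "support_fun K \<theta> + p2 \<theta> = s" for \<theta>
  proof -
    have K_form: "support_fun K = (\<lambda>\<theta>. s + (a * cos \<theta> + b * sin \<theta>))" using s by blast
    have "((\<lambda>\<theta>. s + (a * cos \<theta> + b * sin \<theta>)) has_real_derivative b * cos \<theta> - a * sin \<theta>) (at \<theta>)" for \<theta>
      by (auto intro!: derivative_eq_intros)
    then have "p1 = (\<lambda>\<theta>. b * cos \<theta> - a * sin \<theta>)"
      using p unfolding K_form by (auto intro: DERIV_unique)
    moreover have "((\<lambda>\<theta>. b * cos \<theta> - a * sin \<theta>) has_real_derivative - b * sin \<theta> - a * cos \<theta>) (at \<theta>)" for \<theta>
      by (auto intro!: derivative_eq_intros)
    ultimately have "p2 \<theta> = - b * sin \<theta> - a * cos \<theta>"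
      using p1[of \<theta>] by (auto intro: DERIV_unique)
    then show ?thesis by (simp add: s)
  qed
  have "radius_variance \<le> 2 * pi * 0\<^sup>2" by (rule radius_variance_le[of s 0]) (simp add: rho)
  then have zero: "radius_variance = 0" "deficit = 0" using three_deficit_le deficit_nonneg by auto
  have d: "((\<lambda>\<theta>. support_fun K \<theta> + p2 \<theta>) has_real_derivative p1 \<theta> + p3 \<theta>) (at \<theta>)" for \<theta>
    by (intro DERIV_add p p2)
  have "p1 \<theta> + p3 \<theta> = 0" for \<theta> by (rule DERIV_unique[OF d[unfolded rho] DERIV_const])
  moreover have "max_curv_radius K = s" "min_curv_radius K = s"
    by (simp_all add: max_curv_radius_def min_curv_radius_def curv_radius_eq rho)
  moreover have "(circumradius K - inradius K)\<^sup>2 \<le> 0" using bonnesen_domain(1) zero by simp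
  ultimately show ?thesis using assms(2) by (simp add: W_eq zero)
qed

lemma W_zero_imp_disk:
  assumes adm: "admissible \<alpha> \<delta> \<mu> \<sigma> \<eta> lam \<xi> \<zeta>" and W0: "W K \<alpha> \<delta> \<mu> \<sigma> \<eta> lam \<xi> \<zeta> = 0"
    and par: "lam\<^sup>2 + \<xi>\<^sup>2 + \<zeta>\<^sup>2 > 0"
  shows "is_disk K"
proof -
  define X where "X = (max_curv_radius K - min_curv_radius K)\<^sup>2 - 2 * deficit / pi"
  define Y where "Y = 2 * deficit / pi - (circumradius K - inradius K)\<^sup>2"
  define Z where "Z = curvature_energy + 2 * radius_variance + perimeter\<^sup>2 / pi"
  have X: "X \<ge> 4 * deficit / pi" and Z: "Z > 0"
    unfolding X_def Z_def by (rule gaps_nonneg)+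
  have nn: "\<xi> * X \<ge> 0" "(- lam) * Y \<ge> 0" "\<zeta> * Z \<ge> 0"
    unfolding X_def Y_def Z_def by (rule weighted_gaps_nonneg[OF adm])+
  have "\<xi> * X + (- lam) * Y + \<zeta> * Z \<le> 0"
    using W_lower_bound[OF adm] W0 unfolding X_def Y_def Z_def by simp
  then have z: "\<xi> * X = 0" "(- lam) * Y = 0" "\<zeta> * Z = 0" using nn by linarith+
  have "\<zeta> = 0" using z(3) Z by simp
  then have "lam \<noteq> 0 \<or> \<xi> \<noteq> 0" using par by auto
  then show ?thesis
  proof
    assume "lam \<noteq> 0"
    then have "(circumradius K - inradius K)\<^sup>2 = 2 * deficit / pi" using z(2) by (simp add: Y_def)
    from bonnesen_domain(2)[OF this] show ?thesis using disk_of_support by blast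
  next
    assume "\<xi> \<noteq> 0"
    then have "4 * deficit / pi \<le> 0" using z(1) X by simp
    then have "deficit \<le> 0" using pos_divide_le_eq[OF pi_gt_zero, of "4 * deficit" 0] by simp
    then show ?thesis using deficit_zero disk_of_support by blast
  qed
qed

end

theorem theorem1p1:
  fixes K :: "(real^2) set"
    and \<alpha> \<delta> \<mu> \<sigma> \<eta> lam \<xi> \<zeta> :: real
  assumes "smooth_strictly_convex_domain K"
  shows "(admissible \<alpha> \<delta> \<mu> \<sigma> \<eta> lam \<xi> \<zeta>
            \<longrightarrow> W K \<alpha> \<delta> \<mu> \<sigma> \<eta> lam \<xi> \<zeta> \<ge> 0)
       \<and> (is_disk K \<and> 2*\<alpha> + 4*pi*\<delta> + \<mu> = 0 \<and> \<zeta> = 0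
            \<longrightarrow> W K \<alpha> \<delta> \<mu> \<sigma> \<eta> lam \<xi> \<zeta> = 0)
       \<and> (W K \<alpha> \<delta> \<mu> \<sigma> \<eta> lam \<xi> \<zeta> = 0 \<and> admissible \<alpha> \<delta> \<mu> \<sigma> \<eta> lam \<xi> \<zeta>
            \<and> lam\<^sup>2 + \<xi>\<^sup>2 + \<zeta>\<^sup>2 > 0
            \<longrightarrow> is_disk K)"
proof -
  obtain p1 p2 p3 where sm: "smooth_periodic (support_fun K) p1 p2 p3" "\<forall>\<theta>. support_fun K \<theta> + p2 \<theta> > 0"
    using domain_support_smooth[OF assms] by blast
  interpret convex_domain K p1 p2 p3
    using assms sm by (intro convex_domain.intro)
      (auto simp: smooth_strictly_convex_domain_def strictly_convex_def)
  have "W K \<alpha> \<delta> \<mu> \<sigma> \<eta> lam \<xi> \<zeta> \<ge> 0" if adm: "admissible \<alpha> \<delta> \<mu> \<sigma> \<eta> lam \<xi> \<zeta>"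
    using W_lower_bound[OF adm] weighted_gaps_nonneg[OF adm] by linarith
  then show ?thesis using W_disk W_zero_imp_disk by blast
qed

end
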